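(* Consider a one-sided truncated exponential family with natural parameter $\theta\in\Theta\subset\mathbb R^d$ and truncation parameter $\gamma\in I$. Let $\chi=\partial_\gamma+A^{(1,1)}_ig^{ij}\partial_j$, a vector field on the family, and let $\mathcal L_\chi$ be the Lie derivative along $\chi$. Let $\pi$ be a smooth positive prior density on $\Theta\times I$. (1) The condition for $\pi$ to be a probability matching prior for $\gamma$, namely $$\partial_\gamma\log\pi+A^{(1,1)}_ig^{ij}\partial_j\log\pi=\partial_\gamma\log c-(\partial_iA^{(1,1)}_j)g^{ij}+A^{(1,1)}_ig^{ij}\Big\{\partial_j\log c+\partial_j\log(\det g_\theta)+\big(\Gamma^g_{mk,j}-\Gamma^g_{kj,m}\big)g^{km}\Big\},$$ takes the form $$\mathcal L_\chi\Big\{\log\pi-\log(\det g_\theta)-\tfrac12\log g_{\gamma\gamma}\Big\}=0.$$ (2) The condition for $\pi$ to be a moment matching prior for $\gamma$, namely $$\partial_\gamma\log\pi+\tfrac12A^{(2,1)}_{ij}g^{ij}-2\,\partial_\gamma\log c+A^{(1,1)}_ig^{ij}\Big\{\partial_j\log\pi-2\,\partial_j\log c+\tfrac12A^{(3,0)}_{jkm}g^{km}\Big\}=0,$$ takes the form $$\mathcal L_\chi\Big\{\log\pi-\tfrac12\log(\det g_\theta)-\log g_{\gamma\gamma}\Big\}=0.$$ That is, in each case the two partial differential equations are equivalent.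
   Context: One-sided truncated exponential family (oTEF): $\Theta\subset\mathbb R^d$ is open, $I=(I_1,I_2)$ is an open interval with $-\infty\le I_1<I_2\le\infty$, and $\{P_{\theta,\gamma}:\theta\in\Theta,\gamma\in I\}$ are probability distributions with Lebesgue densities $p(x;\theta,\gamma)=q(x;\theta)e^{-\psi(\theta,\gamma)}\mathbf 1_{[\gamma,I_2)}(x)$, $x\in I$, where $q(x;\theta)=\exp\{\sum_{i=1}^d\theta^iF_i(x)+M(x)\}$, $M\in C(I)$, $F_i\in C^\infty(I)$. The family is identifiable in the sense that $P_{\theta_1,\gamma}=P_{\theta_2,\gamma}$ implies $\theta_1=\theta_2$, and $p(x;\theta,\gamma)$ is infinitely differentiable in $\theta$ and $\gamma$ for $x\in(\gamma,I_2)$. Notation: $\partial_i=\partial/\partial\theta^i$, $\partial_\gamma=\partial/\partial\gamma$; $l=\log p(X;\theta,\gamma)$, differentiated on the support; expectations are under $P_{\theta,\gamma}$. All quantities are functions of $(\theta,\gamma)$: $A^{(1,1)}_i=E[\partial_i\partial_\gamma l]$, $A^{(2,1)}_{ij}=E[\partial_i\partial_j\partial_\gamma l]$, $A^{(3,0)}_{ijk}=E[\partial_i\partial_j\partial_kl]$, $c=E[\partial_\gamma l]=-\partial_\gamma\psi$, $g_{ij}=-E[\partial_i\partial_jl]$, $g_\theta=(g_{ij})_{1\le i,j\le d}$, $(g^{ij})=g_\theta^{-1}$, $g_{\gamma\gamma}=(\partial_\gamma\psi)^2$, $\Gamma^g_{ij,k}=\frac12(\partial_ig_{jk}+\partial_jg_{ki}-\partial_kg_{ij})$.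 Einstein summation over repeated upper/lower indices running over $1,\dots,d$ is used. $\partial_i$ in $(\partial_iA^{(1,1)}_j)g^{ij}$ acts on $A^{(1,1)}_j$ only. The Lie derivative of a function $f$ along $\chi$ is $\mathcal L_\chi f=\chi(f)=\partial_\gamma f+A^{(1,1)}_ig^{ij}\partial_jf$. *)

theory Defs
  imports "HOL-Probability.Probability"
begin

text \<open>Only meant for open \<open>S\<close>: \<open>f\<close> is \<open>k\<close> times continuously differentiable on \<open>S\<close> if it is
  differentiable there and all its partial derivatives are \<open>k - 1\<close> times continuously differentiable.\<close>

primrec Ck_on :: "nat \<Rightarrow> 'a::euclidean_space set \<Rightarrow> ('a \<Rightarrow> real) \<Rightarrow> bool" where
  "Ck_on 0 S f \<longleftrightarrow> continuous_on S f"
| "Ck_on (Suc k) S f \<longleftrightarrow>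
     (\<exists>f'. (\<forall>x\<in>S. (f has_derivative f' x) (at x)) \<and> (\<forall>b\<in>Basis. Ck_on k S (\<lambda>x. f' x b)))"

definition smooth_on :: "'a::euclidean_space set \<Rightarrow> ('a \<Rightarrow> real) \<Rightarrow> bool" where
  "smooth_on S f \<longleftrightarrow> (\<forall>k. Ck_on k S f)"

definition dtheta :: "'d::finite \<Rightarrow> (real^'d \<Rightarrow> real \<Rightarrow> real) \<Rightarrow> real^'d \<Rightarrow> real \<Rightarrow> real" where
  "dtheta i f \<theta> \<gamma> = deriv (\<lambda>t. f (\<theta> + t *\<^sub>R axis i 1) \<gamma>) 0"

definition dgamma :: "(real^'d::finite \<Rightarrow> real \<Rightarrow> real) \<Rightarrow> real^'d \<Rightarrow> real \<Rightarrow> real" where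
  "dgamma f \<theta> \<gamma> = deriv (\<lambda>s. f \<theta> s) \<gamma>"

text \<open>Vector fields are given by their components \<open>(X\<^sup>1, \<dots>, X\<^sup>d; X\<^sup>\<gamma>)\<close> in the coordinates
  \<open>(\<theta>, \<gamma>)\<close>.\<close>

definition Lie_derivative ::
  "(real^'d::finite \<Rightarrow> real \<Rightarrow> (real^'d) \<times> real) \<Rightarrow> (real^'d \<Rightarrow> real \<Rightarrow> real) \<Rightarrow> real^'d \<Rightarrow> real \<Rightarrow> real"
where
  "Lie_derivative X f \<theta> \<gamma> =
     snd (X \<theta> \<gamma>) * dgamma f \<theta> \<gamma> + (\<Sum>j\<in>UNIV. fst (X \<theta> \<gamma>) $ j * dtheta j f \<theta> \<gamma>)"

definition oTEF_q :: "('d::finite \<Rightarrow> real \<Rightarrow> real) \<Rightarrow> (real \<Rightarrow> real) \<Rightarrow> real \<Rightarrow> real^'d \<Rightarrow> real" where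
  "oTEF_q F M x \<theta> = exp ((\<Sum>i\<in>UNIV. \<theta> $ i * F i x) + M x)"

definition oTEF_density ::
  "ereal \<Rightarrow> ('d::finite \<Rightarrow> real \<Rightarrow> real) \<Rightarrow> (real \<Rightarrow> real) \<Rightarrow> (real^'d \<Rightarrow> real \<Rightarrow> real)
    \<Rightarrow> real \<Rightarrow> real^'d \<Rightarrow> real \<Rightarrow> real" where
  "oTEF_density I2 F M \<psi> x \<theta> \<gamma> =
     oTEF_q F M x \<theta> * exp (- \<psi> \<theta> \<gamma>) * indicat_real {y. \<gamma> \<le> y \<and> ereal y < I2} x"

definition distr_of_density :: "(real \<Rightarrow> real^'d::finite \<Rightarrow> real \<Rightarrow> real) \<Rightarrow> real^'d \<Rightarrow> real \<Rightarrow> real measure" where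
  "distr_of_density p \<theta> \<gamma> = density lborel (\<lambda>x. ennreal (p x \<theta> \<gamma>))"

locale oTEF =
  fixes \<Theta> :: "(real^'d::finite) set"
    and I1 I2 :: ereal
    and F :: "'d \<Rightarrow> real \<Rightarrow> real"
    and M :: "real \<Rightarrow> real"
    and \<psi> :: "real^'d \<Rightarrow> real \<Rightarrow> real"
  assumes open_Theta: "open \<Theta>"
    and I_nonempty: "I1 < I2"
    and M_continuous: "continuous_on (einterval I1 I2) M"
    and F_smooth: "\<And>i. smooth_on (einterval I1 I2) (F i)"
    and prob: "\<And>\<theta> \<gamma>. \<theta> \<in> \<Theta> \<Longrightarrow> \<gamma> \<in> einterval I1 I2 \<Longrightarrow>
          prob_space (distr_of_density (oTEF_density I2 F M \<psi>) \<theta> \<gamma>)"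
    and identifiable: "\<And>\<theta>1 \<theta>2 \<gamma>. \<theta>1 \<in> \<Theta> \<Longrightarrow> \<theta>2 \<in> \<Theta> \<Longrightarrow> \<gamma> \<in> einterval I1 I2 \<Longrightarrow>
          distr_of_density (oTEF_density I2 F M \<psi>) \<theta>1 \<gamma>
            = distr_of_density (oTEF_density I2 F M \<psi>) \<theta>2 \<gamma> \<Longrightarrow> \<theta>1 = \<theta>2"
    and density_smooth: "\<And>x. x \<in> einterval I1 I2 \<Longrightarrow>
          smooth_on (\<Theta> \<times> {\<gamma> \<in> einterval I1 I2. \<gamma> < x}) (\<lambda>(\<theta>, \<gamma>). oTEF_density I2 F M \<psi> x \<theta> \<gamma>)"

text \<open>Off the support \<open>ln 0\<close> is a junk value, but it does not enter the expectations below,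
  which are taken with respect to the density itself.\<close>

definition loglik :: "(real \<Rightarrow> real^'d::finite \<Rightarrow> real \<Rightarrow> real) \<Rightarrow> real \<Rightarrow> real^'d \<Rightarrow> real \<Rightarrow> real" where
  "loglik p x \<theta> \<gamma> = ln (p x \<theta> \<gamma>)"

definition expct :: "(real \<Rightarrow> real^'d::finite \<Rightarrow> real \<Rightarrow> real) \<Rightarrow> (real \<Rightarrow> real^'d \<Rightarrow> real \<Rightarrow> real)
    \<Rightarrow> real^'d \<Rightarrow> real \<Rightarrow> real" where
  "expct p f \<theta> \<gamma> = (LINT x|distr_of_density p \<theta> \<gamma>. f x \<theta> \<gamma>)"

context
  fixes p :: "real \<Rightarrow> real^'d::finite \<Rightarrow> real \<Rightarrow> real"
begin

definition A11 :: "'d \<Rightarrow> real^'d \<Rightarrow> real \<Rightarrow> real" where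
  "A11 i = expct p (\<lambda>x. dtheta i (dgamma (loglik p x)))"

definition A21 :: "'d \<Rightarrow> 'd \<Rightarrow> real^'d \<Rightarrow> real \<Rightarrow> real" where
  "A21 i j = expct p (\<lambda>x. dtheta i (dtheta j (dgamma (loglik p x))))"

definition A30 :: "'d \<Rightarrow> 'd \<Rightarrow> 'd \<Rightarrow> real^'d \<Rightarrow> real \<Rightarrow> real" where
  "A30 i j k = expct p (\<lambda>x. dtheta i (dtheta j (dtheta k (loglik p x))))"

definition cfun :: "real^'d \<Rightarrow> real \<Rightarrow> real" where
  "cfun = expct p (\<lambda>x. dgamma (loglik p x))"

definition g_lower :: "'d \<Rightarrow> 'd \<Rightarrow> real^'d \<Rightarrow> real \<Rightarrow> real" where
  "g_lower i j \<theta> \<gamma> = - expct p (\<lambda>x. dtheta i (dtheta j (loglik p x))) \<theta> \<gamma>"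

definition g_theta :: "real^'d \<Rightarrow> real \<Rightarrow> real^'d^'d" where
  "g_theta \<theta> \<gamma> = (\<chi> i j. g_lower i j \<theta> \<gamma>)"

definition g_upper :: "'d \<Rightarrow> 'd \<Rightarrow> real^'d \<Rightarrow> real \<Rightarrow> real" where
  "g_upper i j \<theta> \<gamma> = matrix_inv (g_theta \<theta> \<gamma>) $ i $ j"

text \<open>\<open>Christoffel i j k\<close> is \<open>\<Gamma>\<^bsub>ij,k\<^esub>\<close>.\<close>

definition Christoffel :: "'d \<Rightarrow> 'd \<Rightarrow> 'd \<Rightarrow> real^'d \<Rightarrow> real \<Rightarrow> real" where
  "Christoffel i j k \<theta> \<gamma> =
     1/2 * (dtheta i (g_lower j k) \<theta> \<gamma> + dtheta j (g_lower k i) \<theta> \<gamma> - dtheta k (g_lower i j) \<theta> \<gamma>)"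

definition chi_field :: "real^'d \<Rightarrow> real \<Rightarrow> (real^'d) \<times> real" where
  "chi_field \<theta> \<gamma> = ((\<chi> j. \<Sum>i\<in>UNIV. A11 i \<theta> \<gamma> * g_upper i j \<theta> \<gamma>), 1)"

definition prob_matching_eq :: "(real^'d \<Rightarrow> real \<Rightarrow> real) \<Rightarrow> real^'d \<Rightarrow> real \<Rightarrow> bool" where
  "prob_matching_eq \<pi> \<theta> \<gamma> \<longleftrightarrow>
     dgamma (\<lambda>\<theta> \<gamma>. ln (\<pi> \<theta> \<gamma>)) \<theta> \<gamma>
       + (\<Sum>i\<in>UNIV. \<Sum>j\<in>UNIV. A11 i \<theta> \<gamma> * g_upper i j \<theta> \<gamma> * dtheta j (\<lambda>\<theta> \<gamma>. ln (\<pi> \<theta> \<gamma>)) \<theta> \<gamma>)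
     = dgamma (\<lambda>\<theta> \<gamma>. ln (cfun \<theta> \<gamma>)) \<theta> \<gamma>
       - (\<Sum>i\<in>UNIV. \<Sum>j\<in>UNIV. dtheta i (A11 j) \<theta> \<gamma> * g_upper i j \<theta> \<gamma>)
       + (\<Sum>i\<in>UNIV. \<Sum>j\<in>UNIV. A11 i \<theta> \<gamma> * g_upper i j \<theta> \<gamma> *
            (dtheta j (\<lambda>\<theta> \<gamma>. ln (cfun \<theta> \<gamma>)) \<theta> \<gamma>
             + dtheta j (\<lambda>\<theta> \<gamma>. ln (det (g_theta \<theta> \<gamma>))) \<theta> \<gamma>
             + (\<Sum>k\<in>UNIV. \<Sum>m\<in>UNIV.
                  (Christoffel m k j \<theta> \<gamma> - Christoffel k j m \<theta> \<gamma>) * g_upper k m \<theta> \<gamma>)))"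

definition moment_matching_eq :: "(real^'d \<Rightarrow> real \<Rightarrow> real) \<Rightarrow> real^'d \<Rightarrow> real \<Rightarrow> bool" where
  "moment_matching_eq \<pi> \<theta> \<gamma> \<longleftrightarrow>
     dgamma (\<lambda>\<theta> \<gamma>. ln (\<pi> \<theta> \<gamma>)) \<theta> \<gamma>
       + 1/2 * (\<Sum>i\<in>UNIV. \<Sum>j\<in>UNIV. A21 i j \<theta> \<gamma> * g_upper i j \<theta> \<gamma>)
       - 2 * dgamma (\<lambda>\<theta> \<gamma>. ln (cfun \<theta> \<gamma>)) \<theta> \<gamma>
       + (\<Sum>i\<in>UNIV. \<Sum>j\<in>UNIV. A11 i \<theta> \<gamma> * g_upper i j \<theta> \<gamma> *
            (dtheta j (\<lambda>\<theta> \<gamma>. ln (\<pi> \<theta> \<gamma>)) \<theta> \<gamma>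
             - 2 * dtheta j (\<lambda>\<theta> \<gamma>. ln (cfun \<theta> \<gamma>)) \<theta> \<gamma>
             + 1/2 * (\<Sum>k\<in>UNIV. \<Sum>m\<in>UNIV. A30 j k m \<theta> \<gamma> * g_upper k m \<theta> \<gamma>)))
     = 0"

end

definition g_gamma_gamma :: "(real^'d::finite \<Rightarrow> real \<Rightarrow> real) \<Rightarrow> real^'d \<Rightarrow> real \<Rightarrow> real" where
  "g_gamma_gamma \<psi> \<theta> \<gamma> = (dgamma \<psi> \<theta> \<gamma>)\<^sup>2"

end

theory Submission imports Defs begin

text \<open>On its support the log likelihood is \<open>\<Sum>\<^sub>i \<theta>\<^sup>i F\<^sub>i(x) + M(x) - \<psi>(\<theta>, \<gamma>)\<close>. The part depending on
  \<open>x\<close> is affine in \<open>\<theta>\<close> and free of \<open>\<gamma>\<close>, so each derivative in the two partial differential equations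
  kills it and what remains is the deterministic derivative of \<open>- \<psi>\<close>. Hence
  \<open>c = - \<partial>\<^sub>\<gamma> \<psi>\<close>, \<open>g\<^sub>i\<^sub>j = \<partial>\<^sub>i \<partial>\<^sub>j \<psi>\<close>, \<open>A\<^sup>(\<^sup>1\<^sup>,\<^sup>1\<^sup>)\<^sub>j = - \<partial>\<^sub>j \<partial>\<^sub>\<gamma> \<psi>\<close>,
  \<open>A\<^sup>(\<^sup>2\<^sup>,\<^sup>1\<^sup>)\<^sub>i\<^sub>j = - \<partial>\<^sub>\<gamma> g\<^sub>i\<^sub>j\<close> and \<open>A\<^sup>(\<^sup>3\<^sup>,\<^sup>0\<^sup>)\<^sub>i\<^sub>j\<^sub>k = - \<partial>\<^sub>i g\<^sub>j\<^sub>k\<close>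
  (\<open>expct_foldr_pd_loglik\<close>).

  Third derivatives of \<open>\<psi>\<close> are symmetric, so the two Christoffel symbols in the probability matching
  equation cancel. Every contraction of a derivative of \<open>g\<close> with the inverse of \<open>g\<close> is a
  derivative of \<open>log det g\<close>, by Jacobi's formula (\<open>pd_ln_det\<close>). Finally
  \<open>log g\<^sub>\<gamma>\<^sub>\<gamma> = 2 log c\<close>. With these substitutions each equation literally becomes the
  vanishing of the derivative along \<open>\<chi>\<close> of the claimed potential (\<open>matching_equations\<close>).

  These manipulations need \<open>c > 0\<close> and \<open>det g \<noteq> 0\<close>. The first holds since \<open>exp \<psi>\<close> is the integral of
  the positive continuous function \<open>q\<close> over \<open>[\<gamma>, I\<^sub>2)\<close> and decreases at a positive rate as \<open>\<gamma>\<close> grows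
  (\<open>pd_gamma_psi_neg\<close>). For the second, \<open>g\<close> is the covariance matrix of \<open>F\<^sub>1, \<dots>, F\<^sub>d\<close>; if it
  were degenerate in a direction \<open>v\<close>, then \<open>\<Sum>\<^sub>i v\<^sub>i F\<^sub>i\<close> would be almost surely constant and moving
  \<open>\<theta>\<close> along \<open>v\<close> would not change the distribution, against identifiability
  (\<open>hessian_psi_pos\<close>). The smoothness of \<open>\<psi>\<close>, which everything rests on, is inherited from
  the density by taking logarithms at points \<open>x > \<gamma>\<close> (\<open>Ck_on_psi\<close>).\<close>

section \<open>Directional derivatives\<close>

text \<open>With \<open>z = (\<theta>, \<gamma>)\<close> both kinds of coordinate derivative of the family become instances of one
  operator, so that iterated and mixed derivatives can be treated uniformly.\<close>

definition pd :: "'a::euclidean_space \<Rightarrow> ('a \<Rightarrow> real) \<Rightarrow> 'a \<Rightarrow> real" where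
  "pd v f z = deriv (\<lambda>t. f (z + t *\<^sub>R v)) 0"

lemma has_derivative_along_line:
  assumes "(f has_derivative f') (at (z + t *\<^sub>R v))"
  shows "((\<lambda>t. f (z + t *\<^sub>R v)) has_real_derivative f' v) (at t)"
proof -
  have "((\<lambda>t. z + t *\<^sub>R v) has_derivative (\<lambda>s. s *\<^sub>R v)) (at t)"
    by (auto intro!: derivative_eq_intros)
  from has_derivative_compose[OF this assms]
  have "((\<lambda>t. f (z + t *\<^sub>R v)) has_derivative (\<lambda>s. f' (s *\<^sub>R v))) (at t)" .
  moreover have "(\<lambda>s. f' (s *\<^sub>R v)) = (*) (f' v)"
    using linear_scale[OF has_derivative_linear[OF assms]] by (auto simp: mult.commute)
  ultimately show ?thesis by (simp add: has_field_derivative_def)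
qed

lemma pd_eq: "(f has_derivative f') (at z) \<Longrightarrow> pd v f z = f' v"
  unfolding pd_def using has_derivative_along_line[of f f' z 0 v] by (auto intro: DERIV_imp_deriv)

lemma has_derivative_pd:
  assumes "f differentiable at z"
  shows "(f has_derivative (\<lambda>v. pd v f z)) (at z)"
proof -
  obtain f' where f': "(f has_derivative f') (at z)"
    using assms by (auto simp: differentiable_def)
  moreover have "(\<lambda>v. pd v f z) = f'" using pd_eq[OF f'] by auto
  ultimately show ?thesis by simp
qed

lemma has_real_derivative_pd:
  assumes "f differentiable at (z + t *\<^sub>R v)"
  shows "((\<lambda>t. f (z + t *\<^sub>R v)) has_real_derivative pd v f (z + t *\<^sub>R v)) (at t)"
  by (intro has_derivative_along_line has_derivative_pd assms)

lemma pd_sum_direction: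
  assumes "f differentiable at z"
  shows "pd (\<Sum>i\<in>A. c i *\<^sub>R e i) f z = (\<Sum>i\<in>A. c i * pd (e i) f z)"
proof -
  have lin: "linear (\<lambda>v. pd v f z)"
    using has_derivative_linear[OF has_derivative_pd[OF assms]] .
  show ?thesis
    using linear_sum[OF lin, of "\<lambda>i. c i *\<^sub>R e i" A] by (simp add: linear_scale[OF lin])
qed

lemma pd_cong:
  assumes "open U" "z \<in> U" "\<And>y. y \<in> U \<Longrightarrow> f y = g y"
  shows "pd v f z = pd v g z"
proof -
  have "((\<lambda>t. z + t *\<^sub>R v) \<longlongrightarrow> z + 0 *\<^sub>R v) (nhds 0)"
    by (intro tendsto_intros filterlim_ident)
  then have *: "((\<lambda>t. z + t *\<^sub>R v) \<longlongrightarrow> z) (nhds 0)"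
    by simp
  have "eventually (\<lambda>t. z + t *\<^sub>R v \<in> U) (nhds 0)"
    using topological_tendstoD[OF * assms(1,2)] .
  then have "eventually (\<lambda>t. f (z + t *\<^sub>R v) = g (z + t *\<^sub>R v)) (nhds 0)"
    by eventually_elim (auto intro: assms)
  then show ?thesis unfolding pd_def by (intro deriv_cong_ev) auto
qed

lemma pd_const [simp]: "pd v (\<lambda>_. c) z = 0"
  by (simp add: pd_def)

lemma pd_add:
  "f differentiable at z \<Longrightarrow> g differentiable at z \<Longrightarrow> pd v (\<lambda>y. f y + g y) z = pd v f z + pd v g z"
  by (rule pd_eq) (intro has_derivative_add has_derivative_pd)

lemma pd_diff:
  "f differentiable at z \<Longrightarrow> g differentiable at z \<Longrightarrow> pd v (\<lambda>y. f y - g y) z = pd v f z - pd v g z"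
  by (rule pd_eq) (intro has_derivative_diff has_derivative_pd)

lemma pd_cmult:
  "f differentiable at z \<Longrightarrow> pd v (\<lambda>y. c * f y) z = c * pd v f z"
  by (rule pd_eq) (intro has_derivative_mult_right has_derivative_pd)

lemma pd_sum_cmult:
  "(\<And>i. i \<in> A \<Longrightarrow> f i differentiable at z) \<Longrightarrow>
     pd v (\<lambda>y. \<Sum>i\<in>A. c i * f i y) z = (\<Sum>i\<in>A. c i * pd v (f i) z)"
  by (rule pd_eq) (intro has_derivative_sum has_derivative_mult_right has_derivative_pd)

lemma pd_mult:
  "f differentiable at z \<Longrightarrow> g differentiable at z \<Longrightarrow>
     pd v (\<lambda>y. f y * g y) z = f z * pd v g z + pd v f z * g z"
  by (rule pd_eq) (intro has_derivative_mult has_derivative_pd)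

text \<open>The extension \<open>ln (- x) = ln x\<close> makes the logarithm differentiable at negative arguments too; for
  \<open>log det g\<close> it is therefore enough to know that the determinant does not vanish.\<close>

lemma has_derivative_ln_nonzero:
  fixes f :: "'a::real_normed_vector \<Rightarrow> real"
  assumes "(f has_derivative f') (at z)" "f z \<noteq> 0"
  shows "((\<lambda>y. ln (f y)) has_derivative (\<lambda>h. f' h / f z)) (at z)"
proof (cases "f z > 0")
  case True
  then show ?thesis by (auto intro!: derivative_eq_intros assms(1) simp: field_simps)
next
  case False
  then have "((\<lambda>y. ln (- f y)) has_derivative (\<lambda>h. f' h / f z)) (at z)"
    using assms(2) by (auto intro!: derivative_eq_intros assms(1) simp: field_simps)
  then show ?thesis by (simp add: ln_minus)
qed

lemma pd_ln:
  assumes "f differentiable at z" "f z \<noteq> 0"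
  shows "pd v (\<lambda>y. ln (f y)) z = pd v f z / f z" "(\<lambda>y. ln (f y)) differentiable at z"
  using has_derivative_ln_nonzero[OF has_derivative_pd[OF assms(1)] assms(2)]
  by (auto intro: pd_eq simp: differentiable_def)

section \<open>Finitely often differentiable functions\<close>

lemma Ck_on_cong:
  assumes "open S" "Ck_on k S f" "\<And>x. x \<in> S \<Longrightarrow> f x = g x"
  shows "Ck_on k S g"
proof (cases k)
  case 0
  then show ?thesis using assms by (auto cong: continuous_on_cong)
next
  case (Suc m)
  then obtain f' where f': "\<forall>x\<in>S. (f has_derivative f' x) (at x)"
    "\<forall>b\<in>Basis. Ck_on m S (\<lambda>x. f' x b)" using assms(2) by auto
  have "\<forall>x\<in>S. (g has_derivative f' x) (at x)"
    using f'(1) assms(1,3) by (auto intro: has_derivative_transform_within_open)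
  with f'(2) Suc show ?thesis by auto
qed

text \<open>The derivative in the definition of \<open>Ck_on\<close> is only determined on \<open>S\<close>. On an open set it can be
  replaced by the canonical \<open>pd\<close>, which turns the definition into an equivalence usable in inductions.\<close>

lemma Ck_on_Suc_iff:
  assumes "open S"
  shows "Ck_on (Suc k) S f \<longleftrightarrow> (\<forall>x\<in>S. f differentiable at x) \<and> (\<forall>b\<in>Basis. Ck_on k S (pd b f))"
proof
  assume "Ck_on (Suc k) S f"
  then obtain f' where f': "\<forall>x\<in>S. (f has_derivative f' x) (at x)"
    "\<forall>b\<in>Basis. Ck_on k S (\<lambda>x. f' x b)" by auto
  have "Ck_on k S (pd b f)" if "b \<in> Basis" for b
  proof (rule Ck_on_cong[OF assms])
    show "Ck_on k S (\<lambda>x. f' x b)" using f'(2) that by simp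
    show "f' x b = pd b f x" if "x \<in> S" for x using pd_eq[of f "f' x" x b] f'(1) that by simp
  qed
  moreover have "f differentiable at x" if "x \<in> S" for x
    using f'(1) that unfolding differentiable_def by blast
  ultimately show "(\<forall>x\<in>S. f differentiable at x) \<and> (\<forall>b\<in>Basis. Ck_on k S (pd b f))" by simp
next
  assume "(\<forall>x\<in>S. f differentiable at x) \<and> (\<forall>b\<in>Basis. Ck_on k S (pd b f))"
  then show "Ck_on (Suc k) S f"
    by (simp, intro exI[of _ "\<lambda>x v. pd v f x"]) (auto intro: has_derivative_pd)
qed

declare Ck_on.simps(2) [simp del]

lemma Ck_on_imp_differentiable: "Ck_on (Suc k) S f \<Longrightarrow> x \<in> S \<Longrightarrow> f differentiable at x"
  by (auto simp: Ck_on.simps(2) differentiable_def)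

lemma Ck_on_pd: "open S \<Longrightarrow> Ck_on (Suc k) S f \<Longrightarrow> b \<in> Basis \<Longrightarrow> Ck_on k S (pd b f)"
  by (simp add: Ck_on_Suc_iff)

lemma Ck_on_SucD:
  assumes "open S" "Ck_on (Suc k) S f"
  shows "Ck_on k S f"
  using assms(2)
proof (induction k arbitrary: f)
  case 0
  then show ?case
    by (auto intro!: continuous_at_imp_continuous_on differentiable_imp_continuous_within
        dest: Ck_on_imp_differentiable)
next
  case (Suc k)
  have "f differentiable at x" if "x \<in> S" for x
    by (rule Ck_on_imp_differentiable) fact+
  moreover have "Ck_on k S (pd b f)" if "b \<in> Basis" for b
    by (intro Suc.IH Ck_on_pd assms(1) Suc.prems that)
  ultimately show ?case by (simp add: Ck_on_Suc_iff assms(1))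
qed

lemma Ck_on_imp_continuous_on:
  assumes "open S" "Ck_on k S f"
  shows "continuous_on S f"
  using assms(2)
proof (induction k)
  case (Suc k)
  show ?case by (rule Suc.IH[OF Ck_on_SucD[OF assms(1) Suc.prems]])
qed simp

lemma Ck_on_local:
  assumes "open S" "\<And>x. x \<in> S \<Longrightarrow> \<exists>T. open T \<and> x \<in> T \<and> T \<subseteq> S \<and> Ck_on k T f"
  shows "Ck_on k S f"
  using assms(2)
proof (induction k arbitrary: f)
  case 0
  have "isCont f x" if "x \<in> S" for x
    using 0[OF that] by (metis Ck_on.simps(1) continuous_on_eq_continuous_at)
  then show ?case by (auto intro: continuous_at_imp_continuous_on)
next
  case (Suc k)
  have "f differentiable at x" if "x \<in> S" for x
    using Suc.prems[OF that] Ck_on_imp_differentiable by blast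
  moreover have "Ck_on k S (pd b f)" if "b \<in> Basis" for b
  proof (rule Suc.IH)
    fix x assume "x \<in> S"
    from Suc.prems[OF this] obtain T where "open T" "x \<in> T" "T \<subseteq> S" "Ck_on (Suc k) T f" by auto
    then show "\<exists>T. open T \<and> x \<in> T \<and> T \<subseteq> S \<and> Ck_on k T (pd b f)"
      using Ck_on_pd[of T k f b] that by auto
  qed
  ultimately show ?case by (simp add: Ck_on_Suc_iff assms(1))
qed

lemma Ck_on_const: "Ck_on k S (\<lambda>_. c)"
proof (induction k arbitrary: c)
  case (Suc k)
  then show ?case by (auto simp: Ck_on.simps(2) intro!: exI[of _ "\<lambda>_ _. 0"])
qed auto

lemma Ck_on_bounded_linear:
  assumes "bounded_linear f"
  shows "Ck_on k S f"
proof (cases k)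
  case 0
  then show ?thesis using assms by (simp add: linear_continuous_on)
next
  case (Suc m)
  then show ?thesis
    using bounded_linear_imp_has_derivative[OF assms]
    by (auto simp: Ck_on.simps(2) intro!: exI[of _ "\<lambda>_. f"] Ck_on_const)
qed

lemma Ck_on_add:
  assumes "open S" "Ck_on k S f" "Ck_on k S g"
  shows "Ck_on k S (\<lambda>x. f x + g x)"
  using assms(2,3)
proof (induction k arbitrary: f g)
  case (Suc k)
  note diff = Suc.prems[THEN Ck_on_imp_differentiable]
  have "Ck_on k S (pd b (\<lambda>x. f x + g x))" if "b \<in> Basis" for b
    by (rule Ck_on_cong[OF assms(1) Suc.IH[of "pd b f" "pd b g"]])
      (use that Suc.prems diff in \<open>auto simp: pd_add intro: Ck_on_pd assms(1)\<close>)
  then show ?case by (auto simp: Ck_on_Suc_iff assms(1) intro: diff differentiable_add)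
qed (auto intro: continuous_intros)

lemma Ck_on_mult:
  assumes "open S" "Ck_on k S f" "Ck_on k S g"
  shows "Ck_on k S (\<lambda>x. f x * g x)"
  using assms(2,3)
proof (induction k arbitrary: f g)
  case (Suc k)
  note diff = Suc.prems[THEN Ck_on_imp_differentiable]
  have "Ck_on k S (pd b (\<lambda>x. f x * g x))" if "b \<in> Basis" for b
    by (rule Ck_on_cong[OF assms(1) Ck_on_add[OF assms(1) Suc.IH[of f "pd b g"] Suc.IH[of "pd b f" g]]])
      (use that Suc.prems diff in \<open>auto simp: pd_mult intro: Ck_on_pd Ck_on_SucD assms(1)\<close>)
  then show ?case by (auto simp: Ck_on_Suc_iff assms(1) intro: diff differentiable_mult)
qed (auto intro: continuous_intros)

lemma Ck_on_inverse:
  assumes "open S" "Ck_on k S f" "\<And>x. x \<in> S \<Longrightarrow> f x \<noteq> 0"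
  shows "Ck_on k S (\<lambda>x. inverse (f x))"
  using assms(2)
proof (induction k)
  case (Suc k)
  note diff = Suc.prems[THEN Ck_on_imp_differentiable]
  have der: "((\<lambda>x. inverse (f x)) has_derivative (\<lambda>v. (-1) * (inverse (f x) * pd v f x * inverse (f x)))) (at x)"
    if "x \<in> S" for x
    using Deriv.has_derivative_inverse[OF assms(3)[OF that] has_derivative_pd[OF diff[OF that]]] by simp
  have IH: "Ck_on k S (\<lambda>x. inverse (f x))"
    using Suc Ck_on_SucD assms(1) by blast
  have "Ck_on k S (pd b (\<lambda>x. inverse (f x)))" if "b \<in> Basis" for b
  proof (rule Ck_on_cong[OF assms(1)])
    show "Ck_on k S (\<lambda>x. (-1) * (inverse (f x) * pd b f x * inverse (f x)))"
      by (intro Ck_on_mult[OF assms(1)] Ck_on_const IH Ck_on_pd[OF assms(1)] Suc.prems that)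
    show "(-1) * (inverse (f x) * pd b f x * inverse (f x)) = pd b (\<lambda>x. inverse (f x)) x"
      if "x \<in> S" for x using pd_eq[OF der[OF that], of b] by simp
  qed
  then show ?case using der by (auto simp: Ck_on_Suc_iff assms(1) differentiable_def)
qed (use assms in \<open>auto intro!: continuous_intros\<close>)

lemma Ck_on_ln:
  assumes "open S" "Ck_on k S f" "\<And>x. x \<in> S \<Longrightarrow> f x > 0"
  shows "Ck_on k S (\<lambda>x. ln (f x))"
proof (cases k)
  case 0
  then show ?thesis using assms by (auto intro!: continuous_intros simp: less_imp_neq[symmetric] dest: less_imp_neq)
next
  case (Suc m)
  have nz: "f x \<noteq> 0" if "x \<in> S" for x using assms(3)[OF that] by simp
  note diff = assms(2)[unfolded Suc, THEN Ck_on_imp_differentiable]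
  have "Ck_on m S (pd b (\<lambda>x. ln (f x)))" if "b \<in> Basis" for b
    by (rule Ck_on_cong[OF assms(1), of _ "\<lambda>x. pd b f x * inverse (f x)"])
      (use assms nz Suc diff that in
        \<open>auto simp: pd_ln(1) divide_inverse intro!: Ck_on_mult Ck_on_inverse intro: Ck_on_pd Ck_on_SucD\<close>)
  then show ?thesis using diff nz by (auto simp: Suc Ck_on_Suc_iff assms(1) intro: pd_ln(2))
qed

section \<open>Symmetry of second derivatives\<close>

text \<open>The mean value theorem, applied first along \<open>u\<close> to the increment in direction \<open>v\<close> and then along
  \<open>v\<close>. The left-hand side is symmetric in \<open>u\<close> and \<open>v\<close>, which is what yields Schwarz's theorem below.\<close>

lemma second_difference_eq:
  fixes f :: "'a::euclidean_space \<Rightarrow> real"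
  assumes "h > 0"
    and f: "\<And>y. y \<in> U \<Longrightarrow> f differentiable at y"
    and fu: "\<And>y. y \<in> U \<Longrightarrow> pd u f differentiable at y"
    and U: "\<And>s t. 0 \<le> s \<Longrightarrow> s \<le> h \<Longrightarrow> 0 \<le> t \<Longrightarrow> t \<le> h \<Longrightarrow> z + s *\<^sub>R u + t *\<^sub>R v \<in> U"
  obtains s t where "0 < s" "s < h" "0 < t" "t < h"
    "f (z + h *\<^sub>R u + h *\<^sub>R v) - f (z + h *\<^sub>R u) - f (z + h *\<^sub>R v) + f z
       = h * h * pd v (pd u f) (z + s *\<^sub>R u + t *\<^sub>R v)"
proof -
  define a where "a s = f (z + h *\<^sub>R v + s *\<^sub>R u) - f (z + s *\<^sub>R u)" for s
  have "\<exists>s. 0 < s \<and> s < h \<and> a h - a 0 = (h - 0) * (pd u f (z + h *\<^sub>R v + s *\<^sub>R u) - pd u f (z + s *\<^sub>R u))"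
  proof (rule MVT2)
    fix s assume s: "0 \<le> s" "s \<le> h"
    show "(a has_real_derivative pd u f (z + h *\<^sub>R v + s *\<^sub>R u) - pd u f (z + s *\<^sub>R u)) (at s)"
      unfolding a_def using U[OF s, of h] U[OF s, of 0] assms(1)
      by (intro DERIV_diff has_real_derivative_pd f) (auto simp: algebra_simps)
  qed fact
  then obtain s where s: "0 < s" "s < h"
    "a h - a 0 = h * (pd u f (z + h *\<^sub>R v + s *\<^sub>R u) - pd u f (z + s *\<^sub>R u))" by auto
  have "\<exists>t. 0 < t \<and> t < h \<and> pd u f (z + s *\<^sub>R u + h *\<^sub>R v) - pd u f (z + s *\<^sub>R u + 0 *\<^sub>R v)
     = (h - 0) * pd v (pd u f) (z + s *\<^sub>R u + t *\<^sub>R v)"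
    using s U by (intro MVT2 has_real_derivative_pd fu) (use assms(1) in auto)
  then obtain t where "0 < t" "t < h" "pd u f (z + s *\<^sub>R u + h *\<^sub>R v) - pd u f (z + s *\<^sub>R u)
     = h * pd v (pd u f) (z + s *\<^sub>R u + t *\<^sub>R v)" by auto
  with s show ?thesis
    by (intro that[of s t]) (auto simp: a_def algebra_simps)
qed

lemma pd_commute:
  fixes f :: "'a::euclidean_space \<Rightarrow> real"
  assumes S: "open S" "Ck_on (Suc (Suc k)) S f" "z \<in> S" and u: "u \<in> Basis" and v: "v \<in> Basis"
  shows "pd u (pd v f) z = pd v (pd u f) z"
proof (rule ccontr)
  assume neq: "pd u (pd v f) z \<noteq> pd v (pd u f) z"
  define e where "e = \<bar>pd u (pd v f) z - pd v (pd u f) z\<bar> / 2"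
  have "e > 0" using neq by (simp add: e_def)
  have cont: "isCont (pd a (pd b f)) z" if "a \<in> Basis" "b \<in> Basis" for a b
  proof -
    have "Ck_on k S (pd a (pd b f))" using S that by (intro Ck_on_pd)
    then have "continuous_on S (pd a (pd b f))" by (rule Ck_on_imp_continuous_on[OF S(1)])
    then show ?thesis using S(1,3) by (simp add: continuous_on_eq_continuous_at)
  qed
  obtain r where r: "r > 0" "ball z r \<subseteq> S" using S openE by blast
  obtain r1 where r1: "r1 > 0" "\<And>y. dist y z < r1 \<Longrightarrow> dist (pd u (pd v f) y) (pd u (pd v f) z) < e"
    using cont[OF u v] \<open>e > 0\<close> unfolding continuous_at_eps_delta by blast
  obtain r2 where r2: "r2 > 0" "\<And>y. dist y z < r2 \<Longrightarrow> dist (pd v (pd u f) y) (pd v (pd u f) z) < e"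
    using cont[OF v u] \<open>e > 0\<close> unfolding continuous_at_eps_delta by blast
  define h where "h = min r (min r1 r2) / 3"
  have h: "h > 0" "2 * h < r" "2 * h < r1" "2 * h < r2" using r r1 r2 by (auto simp: h_def)
  have near: "dist (z + s *\<^sub>R a + t *\<^sub>R b) z \<le> 2 * h"
    if "0 \<le> s" "s \<le> h" "0 \<le> t" "t \<le> h" "a \<in> Basis" "b \<in> Basis" for s t and a b :: 'a
  proof -
    have "norm (s *\<^sub>R a + t *\<^sub>R b) \<le> norm (s *\<^sub>R a) + norm (t *\<^sub>R b)" by (rule norm_triangle_ineq)
    also have "\<dots> \<le> 2 * h" using that by simp
    finally show ?thesis by (simp add: dist_norm add.assoc)
  qed
  have inS: "z + s *\<^sub>R a + t *\<^sub>R b \<in> S"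
    if "0 \<le> s" "s \<le> h" "0 \<le> t" "t \<le> h" "a \<in> Basis" "b \<in> Basis" for s t and a b :: 'a
    using near[OF that] r h by (auto simp: dist_commute subset_eq)
  have diff: "f differentiable at y" "a \<in> Basis \<Longrightarrow> pd a f differentiable at y" if "y \<in> S" for y a
    by (rule Ck_on_imp_differentiable[OF S(2) that],
        rule Ck_on_imp_differentiable[OF Ck_on_pd[OF S(1,2)] that])
  obtain s t where st: "0 < s" "s < h" "0 < t" "t < h"
    "f (z + h *\<^sub>R u + h *\<^sub>R v) - f (z + h *\<^sub>R u) - f (z + h *\<^sub>R v) + f z
       = h * h * pd v (pd u f) (z + s *\<^sub>R u + t *\<^sub>R v)"
    by (rule second_difference_eq[of h S f u z v]) (use h diff u v inS in auto)
  obtain s' t' where st': "0 < s'" "s' < h" "0 < t'" "t' < h"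
    "f (z + h *\<^sub>R v + h *\<^sub>R u) - f (z + h *\<^sub>R v) - f (z + h *\<^sub>R u) + f z
       = h * h * pd u (pd v f) (z + s' *\<^sub>R v + t' *\<^sub>R u)"
    by (rule second_difference_eq[of h S f v z u]) (use h diff u v inS in auto)
  have "h * h * pd v (pd u f) (z + s *\<^sub>R u + t *\<^sub>R v) = h * h * pd u (pd v f) (z + s' *\<^sub>R v + t' *\<^sub>R u)"
    using st(5) st'(5) by (simp add: algebra_simps)
  then have "pd v (pd u f) (z + s *\<^sub>R u + t *\<^sub>R v) = pd u (pd v f) (z + s' *\<^sub>R v + t' *\<^sub>R u)"
    using h by simp
  moreover have "dist (pd v (pd u f) (z + s *\<^sub>R u + t *\<^sub>R v)) (pd v (pd u f) z) < e"
    using near[of s t u v] st h u v by (intro r2) auto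
  moreover have "dist (pd u (pd v f) (z + s' *\<^sub>R v + t' *\<^sub>R u)) (pd u (pd v f) z) < e"
    using near[of s' t' v u] st' h u v by (intro r1) auto
  ultimately show False unfolding dist_real_def e_def by (auto simp: abs_if split: if_splits)
qed

section \<open>The derivative of the logarithm of a determinant\<close>

lemma matrix_inv_left: "invertible A \<Longrightarrow> matrix_inv A ** A = mat 1"
  unfolding invertible_def matrix_inv_def by (rule someI2_ex) auto

text \<open>Cramer's rule in the form needed for Jacobi's formula: expand \<open>w\<close> in the rows of \<open>A\<close> with the
  coefficient vector \<open>w A\<^sup>-\<^sup>1\<close>; all terms but the \<open>k\<close>-th produce two equal rows.\<close>

lemma det_replace_row:
  fixes A :: "real^'n^'n"
  assumes "invertible A"
  shows "det (\<chi> i. if i = k then w else A $ i) = (\<Sum>j\<in>UNIV. w $ j * matrix_inv A $ j $ k) * det A"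
proof -
  define c where "c = w v* matrix_inv A"
  have "w = c v* A"
    using assms unfolding c_def
    by (simp add: vector_matrix_mul_assoc matrix_inv_left)
  then have w: "w = (\<Sum>l\<in>UNIV. c $ l *s A $ l)"
    by (simp add: vec_eq_iff vector_matrix_mult_def sum_component mult.commute)
  have row: "det (\<chi> i. if i = k then c $ l *s A $ l else A $ i) = (if l = k then c $ k * det A else 0)" for l
  proof (cases "l = k")
    case True
    have "(\<chi> i. if i = k then A $ k else A $ i) = A" by (simp add: vec_eq_iff)
    then show ?thesis
      unfolding True using det_row_mul[of k "c $ k" "\<lambda>_. A $ k" "\<lambda>i. A $ i"] by simp
  next
    case False
    have "det (\<chi> i. if i = k then A $ l else A $ i) = 0"
      by (rule det_identical_rows[of k l]) (use False in \<open>auto simp: row_def vec_eq_iff\<close>)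
    then show ?thesis using False det_row_mul[of k "c $ l" "\<lambda>_. A $ l" "\<lambda>i. A $ i"] by simp
  qed
  have "det (\<chi> i. if i = k then w else A $ i) = (\<Sum>l\<in>UNIV. det (\<chi> i. if i = k then c $ l *s A $ l else A $ i))"
    unfolding w by (rule det_linear_row_sum) simp
  also have "\<dots> = c $ k * det A" by (simp add: row)
  also have "c $ k = (\<Sum>j\<in>UNIV. w $ j * matrix_inv A $ j $ k)"
    by (simp add: c_def vector_matrix_mult_def mult.commute)
  finally show ?thesis .
qed

text \<open>Jacobi's formula: the product rule on the Leibniz expansion gives a sum of determinants, each with one row
  differentiated, to which the previous lemma applies.\<close>

lemma has_derivative_det:
  fixes G :: "'a::real_normed_vector \<Rightarrow> real^'n^'n"
  assumes "\<And>i j. ((\<lambda>y. G y $ i $ j) has_derivative G' i j) (at z)" and inv: "invertible (G z)"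
  shows "((\<lambda>y. det (G y)) has_derivative
           (\<lambda>h. (\<Sum>i\<in>UNIV. \<Sum>j\<in>UNIV. G' i j h * matrix_inv (G z) $ j $ i) * det (G z))) (at z)"
proof -
  let ?P = "{p. p permutes (UNIV :: 'n set)}"
  have "((\<lambda>y. det (G y)) has_derivative
     (\<lambda>h. \<Sum>p\<in>?P. of_int (sign p) * (\<Sum>k\<in>UNIV. G' k (p k) h * (\<Prod>i\<in>UNIV - {k}. G z $ i $ p i)))) (at z)"
    unfolding det_def by (intro has_derivative_sum has_derivative_mult_right has_derivative_prod assms)
  moreover have "(\<Sum>p\<in>?P. of_int (sign p) * (\<Sum>k\<in>UNIV. G' k (p k) h * (\<Prod>i\<in>UNIV - {k}. G z $ i $ p i)))
    = (\<Sum>i\<in>UNIV. \<Sum>j\<in>UNIV. G' i j h * matrix_inv (G z) $ j $ i) * det (G z)" (is "?L = ?R") for h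
  proof -
    have "?L = (\<Sum>k\<in>UNIV. \<Sum>p\<in>?P. of_int (sign p) * (G' k (p k) h * (\<Prod>i\<in>UNIV - {k}. G z $ i $ p i)))"
      by (subst sum.swap) (simp add: sum_distrib_left)
    also have "\<dots> = (\<Sum>k\<in>UNIV. det (\<chi> i. if i = k then (\<chi> j. G' k j h) else G z $ i))"
    proof (rule sum.cong[OF refl])
      fix k :: 'n
      have "(\<Prod>i\<in>UNIV. (\<chi> i. if i = k then (\<chi> j. G' k j h) else G z $ i) $ i $ p i)
        = G' k (p k) h * (\<Prod>i\<in>UNIV - {k}. G z $ i $ p i)" for p
        by (subst prod.remove[of UNIV k]) auto
      then show "(\<Sum>p\<in>?P. of_int (sign p) * (G' k (p k) h * (\<Prod>i\<in>UNIV - {k}. G z $ i $ p i)))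
        = det (\<chi> i. if i = k then (\<chi> j. G' k j h) else G z $ i)"
        unfolding det_def by simp
    qed
    also have "\<dots> = ?R" by (simp add: det_replace_row[OF inv] sum_distrib_right)
    finally show ?thesis .
  qed
  ultimately show ?thesis by simp
qed

lemma pd_ln_det:
  fixes G :: "'a::euclidean_space \<Rightarrow> real^'n^'n"
  assumes "\<And>i j. (\<lambda>y. G y $ i $ j) differentiable at z" and inv: "invertible (G z)"
  shows "pd v (\<lambda>y. ln (det (G y))) z = (\<Sum>i\<in>UNIV. \<Sum>j\<in>UNIV. pd v (\<lambda>y. G y $ i $ j) z * matrix_inv (G z) $ j $ i)"
    and "(\<lambda>y. ln (det (G y))) differentiable at z"
proof -
  have nz: "det (G z) \<noteq> 0" using inv invertible_det_nz by blast
  note d = has_derivative_det[OF has_derivative_pd[OF assms(1)] inv]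
  show "pd v (\<lambda>y. ln (det (G y))) z = (\<Sum>i\<in>UNIV. \<Sum>j\<in>UNIV. pd v (\<lambda>y. G y $ i $ j) z * matrix_inv (G z) $ j $ i)"
    using pd_eq[OF has_derivative_ln_nonzero[OF d nz], of v] nz by simp
  show "(\<lambda>y. ln (det (G y))) differentiable at z"
    using has_derivative_ln_nonzero[OF d nz] by (auto simp: differentiable_def)
qed

section \<open>Cumulant functions with vanishing curvature\<close>

lemma second_derivative_nonneg_at_min:
  fixes f f' :: "real \<Rightarrow> real"
  assumes "r > 0" and nonneg: "\<And>t. \<bar>t\<bar> < r \<Longrightarrow> f t \<ge> 0" and "f 0 = 0"
    and der: "\<And>t. \<bar>t\<bar> < r \<Longrightarrow> (f has_real_derivative f' t) (at t)"
    and der2: "(f' has_real_derivative D) (at 0)"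
  shows "D \<ge> 0"
proof (rule ccontr)
  assume "\<not> D \<ge> 0"
  have "f' 0 = 0"
    by (rule DERIV_local_min[of f _ 0 r]) (use assms in auto)
  obtain d where d: "d > 0" "\<And>h. 0 < h \<Longrightarrow> h < d \<Longrightarrow> f' h < 0"
    using DERIV_neg_dec_right[OF der2] \<open>\<not> D \<ge> 0\<close> \<open>f' 0 = 0\<close> by auto
  define t where "t = min d r / 2"
  have t: "0 < t" "t < d" "t < r" using d assms(1) by (auto simp: t_def)
  have "\<exists>s. 0 < s \<and> s < t \<and> f t - f 0 = (t - 0) * f' s"
    by (rule MVT2) (use t der in auto)
  then obtain s where "0 < s" "s < t" "f t = t * f' s" using assms(3) by auto
  moreover have "t * f' s < 0" using d(2)[of s] t calculation by (simp add: mult_pos_neg)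
  moreover have "f t \<ge> 0" using nonneg t by simp
  ultimately show False by simp
qed

text \<open>The crude constant \<open>1/2\<close> (instead of the optimal \<open>1\<close>) follows from the Taylor bound of one exponential and
  the tangent bound of the other; only the quadratic order matters later.\<close>

lemma exp_plus_exp_minus_ge: "exp u + exp (- u) - 2 \<ge> u\<^sup>2 / 2" for u :: real
proof -
  have *: "exp u + exp (- u) - 2 \<ge> u\<^sup>2 / 2" if "u \<ge> 0" for u :: real
    using exp_lower_Taylor_quadratic[OF that] exp_ge_add_one_self[of "- u"] by simp
  show ?thesis using *[of u] *[of "- u"] by (cases "u \<ge> 0") auto
qed

text \<open>If \<open>h\<close> is the cumulant function of \<open>G\<close> under the density \<open>f\<close>, then \<open>h''(0)\<close> is the variance of
  \<open>G\<close>. Differentiation under the integral sign is avoided: after centring \<open>G\<close> at \<open>m = h'(0)\<close> to \<open>u\<close>, the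
  symmetric second difference of the moment generating function \<open>W\<close> dominates half of \<open>t\<^sup>2 \<integral> f u\<^sup>2\<close>, and
  letting \<open>t \<rightarrow> 0\<close> gives \<open>h''(0) \<ge> \<integral> f u\<^sup>2 / 2\<close>. So \<open>h''(0) \<le> 0\<close> forces \<open>u = 0\<close> where \<open>f\<close> is
  nonzero.\<close>

lemma cumulant_second_derivative_nonpos_imp_AE_const:
  fixes f G :: "'a \<Rightarrow> real" and h h' :: "real \<Rightarrow> real"
  assumes [measurable]: "f \<in> borel_measurable N" "G \<in> borel_measurable N"
    and f_nonneg: "\<And>x. f x \<ge> 0"
    and "r > 0"
    and int: "\<And>t. \<bar>t\<bar> < r \<Longrightarrow> has_bochner_integral N (\<lambda>x. f x * exp (t * G x)) (exp (h t))"
    and "h 0 = 0"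
    and der: "\<And>t. \<bar>t\<bar> < r \<Longrightarrow> (h has_real_derivative h' t) (at t)"
    and der2: "(h' has_real_derivative D) (at 0)"
    and "D \<le> 0"
  shows "AE x in N. f x = 0 \<or> G x = h' 0"
proof -
  define m where "m = h' 0"
  define u where "u x = G x - m" for x
  have [measurable]: "u \<in> borel_measurable N" unfolding u_def by measurable
  \<comment> \<open>The moment generating function of the centred variable \<open>u\<close>.\<close>
  define W where "W t = exp (h t - t * m)" for t
  have W: "has_bochner_integral N (\<lambda>x. f x * exp (t * u x)) (W t)" if "\<bar>t\<bar> < r" for t
  proof -
    have "has_bochner_integral N (\<lambda>x. exp (- (t * m)) * (f x * exp (t * G x))) (exp (- (t * m)) * exp (h t))"
      by (intro has_bochner_integral_mult_right int that)
    moreover have "(\<lambda>x. exp (- (t * m)) * (f x * exp (t * G x))) = (\<lambda>x. f x * exp (t * u x))"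
      by (auto simp: u_def algebra_simps exp_diff exp_minus fun_eq_iff field_simps)
    ultimately show ?thesis by (simp add: W_def exp_diff exp_minus field_simps)
  qed
  have sym: "has_bochner_integral N (\<lambda>x. f x * exp (t * u x) + f x * exp (- t * u x) - 2 * (f x * exp (0 * u x)))
      (W t + W (- t) - 2 * W 0)" if "\<bar>t\<bar> < r" for t
    by (intro has_bochner_integral_add has_bochner_integral_diff has_bochner_integral_mult_right W)
       (use that \<open>r > 0\<close> in auto)
  have "W 0 = 1" by (simp add: W_def \<open>h 0 = 0\<close>)
  have bound: "f x * exp (t * u x) + f x * exp (- t * u x) - 2 * (f x * exp (0 * u x)) \<ge> t\<^sup>2 / 2 * (f x * (u x)\<^sup>2)" for t x
  proof -
    have "f x * (exp (t * u x) + exp (- (t * u x)) - 2) \<ge> f x * ((t * u x)\<^sup>2 / 2)"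
      by (intro mult_left_mono exp_plus_exp_minus_ge f_nonneg)
    then show ?thesis by (simp add: algebra_simps power_mult_distrib)
  qed
  have integrable: "integrable N (\<lambda>x. f x * (u x)\<^sup>2)"
  proof -
    define t where "t = r / 2"
    have t: "t > 0" "\<bar>t\<bar> < r" using \<open>r > 0\<close> by (auto simp: t_def)
    have "integrable N (\<lambda>x. t\<^sup>2 / 2 * (f x * (u x)\<^sup>2))"
    proof (rule Bochner_Integration.integrable_bound)
      show "integrable N (\<lambda>x. f x * exp (t * u x) + f x * exp (- t * u x) - 2 * (f x * exp (0 * u x)))"
        using sym[OF t(2)] by (auto simp: integrable.simps)
      show "AE x in N. norm (t\<^sup>2 / 2 * (f x * (u x)\<^sup>2))
        \<le> norm (f x * exp (t * u x) + f x * exp (- t * u x) - 2 * (f x * exp (0 * u x)))"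
      proof (rule AE_I2)
        fix x
        have "t\<^sup>2 / 2 * (f x * (u x)\<^sup>2) \<ge> 0" using f_nonneg[of x] by simp
        then show "norm (t\<^sup>2 / 2 * (f x * (u x)\<^sup>2))
          \<le> norm (f x * exp (t * u x) + f x * exp (- t * u x) - 2 * (f x * exp (0 * u x)))"
          using bound[of t x] by (simp only: real_norm_def abs_of_nonneg)
      qed
    qed measurable
    then have "t\<^sup>2 / 2 = 0 \<or> integrable N (\<lambda>x. f x * (u x)\<^sup>2)" by (simp only: integrable_mult_left_iff)
    then show ?thesis using t(1) by simp
  qed
  define V where "V = (LINT x|N. f x * (u x)\<^sup>2)"
  define \<phi> where "\<phi> t = W t + W (- t) - 2 - t\<^sup>2 / 2 * V" for t
  have \<phi>_nonneg: "\<phi> t \<ge> 0" if "\<bar>t\<bar> < r" for t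
  proof -
    have "(LINT x|N. t\<^sup>2 / 2 * (f x * (u x)\<^sup>2))
      \<le> (LINT x|N. f x * exp (t * u x) + f x * exp (- t * u x) - 2 * (f x * exp (0 * u x)))"
    proof (intro integral_mono bound integrable_mult_right integrable)
      show "integrable N (\<lambda>x. f x * exp (t * u x) + f x * exp (- t * u x) - 2 * (f x * exp (0 * u x)))"
        using sym[OF that] by (auto simp: integrable.simps)
    qed
    also have "\<dots> = W t + W (- t) - 2 * W 0" by (rule has_bochner_integral_integral_eq[OF sym[OF that]])
    finally show ?thesis by (simp add: \<phi>_def V_def \<open>W 0 = 1\<close>)
  qed
  define W' where "W' t = W t * (h' t - m)" for t
  have W': "(W has_real_derivative W' t) (at t)" if "\<bar>t\<bar> < r" for t
    unfolding W_def W'_def using der[OF that] by (auto intro!: derivative_eq_intros)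
  have W'': "(W' has_real_derivative D) (at 0)"
  proof -
    have "(W' has_real_derivative W' 0 * (h' 0 - m) + D * W 0) (at 0)"
      unfolding W'_def using \<open>r > 0\<close>
      by (auto intro!: derivative_eq_intros W'[unfolded W'_def] der2)
    then show ?thesis by (simp add: m_def \<open>W 0 = 1\<close>)
  qed
  \<comment> \<open>\<open>\<phi>\<close> is nonnegative and vanishes at \<open>0\<close>, and its second derivative there is \<open>2 D - V\<close>.\<close>
  have "2 * D - V \<ge> 0"
  proof (rule second_derivative_nonneg_at_min[OF \<open>r > 0\<close>])
    show "\<phi> t \<ge> 0" if "\<bar>t\<bar> < r" for t by (rule \<phi>_nonneg[OF that])
    show "\<phi> 0 = 0" by (simp add: \<phi>_def \<open>W 0 = 1\<close>)
    show "(\<phi> has_real_derivative W' t - W' (- t) - t * V) (at t)" if "\<bar>t\<bar> < r" for t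
    proof -
      have "((\<lambda>t. W (- t)) has_real_derivative W' (- t) * (- 1)) (at t)"
        by (rule DERIV_chain2[where g = uminus]) (use that in \<open>auto intro!: W' derivative_eq_intros\<close>)
      then show ?thesis
        unfolding \<phi>_def using that by (auto intro!: derivative_eq_intros W')
    qed
    show "((\<lambda>t. W' t - W' (- t) - t * V) has_real_derivative 2 * D - V) (at 0)"
    proof -
      have "((\<lambda>t. W' (- t)) has_real_derivative D * (- 1)) (at 0)"
        by (rule DERIV_chain2[where g = uminus]) (use W'' in \<open>auto intro!: derivative_eq_intros\<close>)
      then show ?thesis using W'' by (auto intro!: derivative_eq_intros)
    qed
  qed
  moreover have "V \<ge> 0" unfolding V_def by (intro integral_nonneg_AE) (simp add: f_nonneg)
  ultimately have "V = 0" using \<open>D \<le> 0\<close> by simp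
  then have "AE x in N. f x * (u x)\<^sup>2 = 0"
    unfolding V_def using integral_nonneg_eq_0_iff_AE[OF integrable] f_nonneg by simp
  then show ?thesis by eventually_elim (simp add: u_def m_def)
qed

section \<open>Coordinates\<close>

lemma case_prod_dtheta: "case_prod (dtheta i f) = pd (axis i 1, 0) (case_prod f)"
  by (auto simp: fun_eq_iff dtheta_def pd_def)

lemma case_prod_dgamma: "case_prod (dgamma f) = pd (0, 1) (case_prod f)"
proof -
  have "(f \<theta> has_real_derivative D) (at \<gamma>) \<longleftrightarrow> ((\<lambda>t. f \<theta> (\<gamma> + t)) has_real_derivative D) (at 0)" for D \<theta> \<gamma>
    using DERIV_shift[of "f \<theta>" D 0 \<gamma>] by (simp add: add.commute)
  then show ?thesis by (auto simp: fun_eq_iff dgamma_def pd_def deriv_def)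
qed

lemma dtheta_eq_pd: "dtheta i f \<theta> \<gamma> = pd (axis i 1, 0) (case_prod f) (\<theta>, \<gamma>)"
  by (simp flip: case_prod_dtheta)

lemma dgamma_eq_pd: "dgamma f \<theta> \<gamma> = pd (0, 1) (case_prod f) (\<theta>, \<gamma>)"
  by (simp flip: case_prod_dgamma)

lemma axis_in_Basis_prod: "(axis i 1, 0) \<in> (Basis :: ((real^'d) \<times> real) set)"
  by (auto simp: Basis_prod_def Basis_vec_def)

lemma snd_in_Basis_prod: "(0, 1) \<in> (Basis :: ((real^'d) \<times> real) set)"
  by (auto simp: Basis_prod_def)

section \<open>Iterated partial derivatives\<close>

lemma foldr_pd_cong:
  assumes "open U" "z \<in> U" "\<And>y. y \<in> U \<Longrightarrow> f y = g y"
  shows "foldr pd vs f z = foldr pd vs g z"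
  using assms(2)
proof (induction vs arbitrary: z)
  case Nil
  then show ?case by (simp add: assms(3))
next
  case (Cons v vs)
  show ?case using pd_cong[OF assms(1) Cons.prems Cons.IH] by simp
qed

lemma Ck_on_foldr_pd:
  assumes "open S" "Ck_on (length vs + k) S f" "set vs \<subseteq> Basis"
  shows "Ck_on k S (foldr pd vs f)"
  using assms(2,3)
proof (induction vs arbitrary: k)
  case (Cons v vs)
  then have "Ck_on (Suc k) S (foldr pd vs f)" by simp
  then show ?case using Ck_on_pd[OF assms(1)] Cons.prems(2) by simp
qed simp

lemma foldr_pd_diff:
  assumes S: "open S" and z: "z \<in> S"
    and "Ck_on (length vs) S f" "Ck_on (length vs) S g" "set vs \<subseteq> Basis"
  shows "foldr pd vs (\<lambda>y. f y - g y) z = foldr pd vs f z - foldr pd vs g z"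
  using z assms(3-)
proof (induction vs arbitrary: z)
  case (Cons v vs)
  have k: "Ck_on (length vs) S f" "Ck_on (length vs) S g"
    using Cons.prems Ck_on_SucD[OF S] by auto
  have diff: "foldr pd vs f differentiable at z" "foldr pd vs g differentiable at z"
    using Cons.prems
    by (auto intro!: Ck_on_imp_differentiable[of 0 S] Ck_on_foldr_pd[OF S])
  have "foldr pd (v # vs) (\<lambda>y. f y - g y) z = pd v (\<lambda>y. foldr pd vs f y - foldr pd vs g y) z"
    using pd_cong[OF S Cons.prems(1) Cons.IH] k Cons.prems by simp
  then show ?case using diff by (simp add: pd_diff)
qed simp

lemma foldr_pd_const: "vs \<noteq> [] \<Longrightarrow> foldr pd vs (\<lambda>_. c) = (\<lambda>_. 0)"
proof (induction vs)
  case (Cons v vs)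
  have "pd v (\<lambda>_. c) = (\<lambda>_. 0)" for c :: real by (rule ext) simp
  then show ?case using Cons by (cases "vs = []") auto
qed simp

section \<open>The family\<close>

text \<open>The exponent of \<open>q\<close>, taken as a function on the product space in which derivatives are formed.\<close>

definition exponent :: "('d::finite \<Rightarrow> real \<Rightarrow> real) \<Rightarrow> (real \<Rightarrow> real) \<Rightarrow> real \<Rightarrow> (real^'d) \<times> real \<Rightarrow> real" where
  "exponent F M x z = (\<Sum>i\<in>UNIV. F i x * fst z $ i) + M x"

lemma bounded_linear_exponent: "bounded_linear (\<lambda>z::(real^'d::finite) \<times> real. \<Sum>i\<in>UNIV. F i x * fst z $ i)"
  by (intro bounded_linear_sum bounded_linear_const_mult
      bounded_linear_compose[OF bounded_linear_vec_nth bounded_linear_fst])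

lemma Ck_on_exponent: "open S \<Longrightarrow> Ck_on k S (exponent F M x)"
  unfolding exponent_def[abs_def]
  by (intro Ck_on_add Ck_on_const Ck_on_bounded_linear bounded_linear_exponent)

lemma pd_exponent: "pd v (exponent F M x) = (\<lambda>_. \<Sum>i\<in>UNIV. F i x * fst v $ i)"
proof
  fix z
  have "(exponent F M x has_derivative (\<lambda>z. (\<Sum>i\<in>UNIV. F i x * fst z $ i) + 0)) (at z)"
    unfolding exponent_def[abs_def]
    by (intro has_derivative_add has_derivative_const bounded_linear_imp_has_derivative bounded_linear_exponent)
  from pd_eq[OF this] show "pd v (exponent F M x) z = (\<Sum>i\<in>UNIV. F i x * fst v $ i)" by simp
qed

lemma foldr_pd_exponent:
  assumes "length vs \<ge> 2 \<or> vs = [(0, 1)]"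
  shows "foldr pd vs (exponent F M x) = (\<lambda>_. 0)"
proof (cases "vs = [(0, 1)]")
  case True
  then show ?thesis by (simp add: pd_exponent)
next
  case False
  then have l: "length vs \<ge> 2" using assms by simp
  then obtain us v where vs: "vs = us @ [v]" by (cases vs rule: rev_cases) auto
  with l have "us \<noteq> []" by auto
  then show ?thesis by (simp add: vs pd_exponent foldr_pd_const)
qed

context oTEF
begin

abbreviation "I \<equiv> einterval I1 I2"
abbreviation "p \<equiv> oTEF_density I2 F M \<psi>"
abbreviation "\<Psi> \<equiv> case_prod \<psi>"

lemma open_domain: "open (\<Theta> \<times> I)"
  by (intro open_Times open_Theta open_einterval)

lemma p_nonneg: "p x \<theta> \<gamma> \<ge> 0"
  by (simp add: oTEF_density_def oTEF_q_def)

lemma p_on_support: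
  "\<gamma> \<le> x \<Longrightarrow> ereal x < I2 \<Longrightarrow> p x \<theta> \<gamma> = exp (exponent F M x (\<theta>, \<gamma>) - \<psi> \<theta> \<gamma>)"
  by (simp add: oTEF_density_def oTEF_q_def exponent_def exp_diff exp_minus divide_inverse mult.commute)

lemma p_off_support: "x < \<gamma> \<or> I2 \<le> ereal x \<Longrightarrow> p x \<theta> \<gamma> = 0"
  by (auto simp: oTEF_density_def indicator_def)

lemma support_subset: "\<gamma> \<in> I \<Longrightarrow> \<gamma> \<le> x \<Longrightarrow> ereal x < I2 \<Longrightarrow> x \<in> I"
  by (auto simp: einterval_iff intro: less_le_trans)

lemma ex_greater_in_I: "\<gamma> \<in> I \<Longrightarrow> \<exists>x\<in>I. \<gamma> < x"
proof -
  assume "\<gamma> \<in> I"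
  then have "ereal \<gamma> < I2" "I1 < ereal \<gamma>" by (auto simp: einterval_iff)
  then obtain x where "ereal \<gamma> < ereal x" "ereal x < I2" using ereal_dense2 by blast
  moreover have "I1 < ereal x" using \<open>I1 < ereal \<gamma>\<close> \<open>ereal \<gamma> < ereal x\<close> by (rule less_trans)
  ultimately show ?thesis by (auto simp: einterval_iff)
qed

text \<open>For fixed \<open>x\<close> the density is smooth only where \<open>\<gamma> < x\<close>, but there \<open>\<psi>\<close> differs from \<open>- ln p\<close> by an
  affine function; each point of the domain lies in such a region for some \<open>x\<close>.\<close>

lemma Ck_on_psi: "Ck_on k (\<Theta> \<times> I) \<Psi>"
proof (rule Ck_on_local[OF open_domain])
  fix z assume z: "z \<in> \<Theta> \<times> I"
  then obtain x where x: "x \<in> I" "snd z < x" using ex_greater_in_I[of "snd z"] by auto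
  define T where "T = \<Theta> \<times> (I \<inter> {..<x})"
  have T: "open T" unfolding T_def by (intro open_Times open_Int open_Theta open_einterval open_lessThan)
  have eq: "\<gamma> \<in> I \<Longrightarrow> \<gamma> < x \<Longrightarrow> p x \<theta> \<gamma> = exp (exponent F M x (\<theta>, \<gamma>) - \<psi> \<theta> \<gamma>)" for \<theta> \<gamma>
    using x by (intro p_on_support) (auto simp: einterval_iff)
  have "I \<inter> {..<x} = {\<gamma> \<in> I. \<gamma> < x}" by auto
  then have "Ck_on k T (\<lambda>(\<theta>, \<gamma>). p x \<theta> \<gamma>)"
    using density_smooth[OF x(1)] by (simp add: smooth_on_def T_def)
  then have "Ck_on k T (\<lambda>z. exponent F M x z + (- 1) * ln (case z of (\<theta>, \<gamma>) \<Rightarrow> p x \<theta> \<gamma>))"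
    by (intro Ck_on_add Ck_on_mult Ck_on_const Ck_on_ln Ck_on_exponent T) (auto simp: T_def eq)
  then have "Ck_on k T \<Psi>"
    by (rule Ck_on_cong[OF T]) (auto simp: T_def eq)
  then show "\<exists>T. open T \<and> z \<in> T \<and> T \<subseteq> \<Theta> \<times> I \<and> Ck_on k T \<Psi>"
    using T z x by (intro exI[of _ T]) (auto simp: T_def)
qed

lemma F_continuous: "continuous_on I (F i)"
  using F_smooth[of i] by (auto simp: smooth_on_def dest: spec[of _ 0])

lemma q_measurable: "(\<lambda>x. indicator I x *\<^sub>R oTEF_q F M x \<theta>) \<in> borel_measurable borel"
  unfolding oTEF_q_def
  by (intro borel_measurable_continuous_on_indicator borel_einterval continuous_intros F_continuous M_continuous)

text \<open>\<open>F\<close> and \<open>M\<close> are controlled only on \<open>I\<close>, so \<open>q\<close> is first cut off outside \<open>I\<close>, which contains the support.\<close>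

lemma p_measurable:
  assumes "\<gamma> \<in> I"
  shows "(\<lambda>x. p x \<theta> \<gamma>) \<in> borel_measurable borel"
proof -
  have "(\<lambda>x. p x \<theta> \<gamma>) = (\<lambda>x. (indicator I x *\<^sub>R oTEF_q F M x \<theta>) * exp (- \<psi> \<theta> \<gamma>)
      * indicat_real {y. \<gamma> \<le> y \<and> ereal y < I2} x)"
    using support_subset[OF assms] by (auto simp: fun_eq_iff oTEF_density_def split: split_indicator)
  moreover have "\<dots> \<in> borel_measurable borel"
    by (intro borel_measurable_times q_measurable borel_measurable_const borel_measurable_indicator) measurable
  ultimately show ?thesis by simp
qed

lemma p_has_integral:
  assumes "\<theta> \<in> \<Theta>" "\<gamma> \<in> I"
  shows "has_bochner_integral lborel (\<lambda>x. p x \<theta> \<gamma>) 1"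
proof (rule has_bochner_integral_nn_integral)
  have m [measurable]: "(\<lambda>x. p x \<theta> \<gamma>) \<in> borel_measurable borel" by (rule p_measurable[OF assms(2)])
  show "(\<lambda>x. p x \<theta> \<gamma>) \<in> borel_measurable lborel" by simp
  interpret P: prob_space "distr_of_density p \<theta> \<gamma>" by (rule prob[OF assms])
  have "emeasure (distr_of_density p \<theta> \<gamma>) UNIV = 1"
    using P.emeasure_space_1 by (simp add: distr_of_density_def)
  then show "(\<integral>\<^sup>+ x. ennreal (p x \<theta> \<gamma>) \<partial>lborel) = ennreal 1"
    unfolding distr_of_density_def by (subst (asm) emeasure_density) auto
qed (auto simp: p_nonneg)

text \<open>The truncation point \<open>x = \<gamma>\<close>, where the log likelihood jumps as a function of \<open>\<gamma>\<close>, is a null set.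
  Prescribing the values off the support makes \<open>f\<close> measurable; the Bochner integral of a nonmeasurable
  function would be zero by default.\<close>

lemma expct_eq_const:
  assumes "\<theta> \<in> \<Theta>" "\<gamma> \<in> I"
    and on: "\<And>x. \<gamma> < x \<Longrightarrow> ereal x < I2 \<Longrightarrow> f x \<theta> \<gamma> = K"
    and off: "\<And>x. x < \<gamma> \<or> I2 \<le> ereal x \<Longrightarrow> f x \<theta> \<gamma> = 0"
  shows "expct p f \<theta> \<gamma> = K"
proof -
  interpret P: prob_space "distr_of_density p \<theta> \<gamma>" by (rule prob[OF assms(1,2)])
  have [measurable]: "(\<lambda>x. p x \<theta> \<gamma>) \<in> borel_measurable borel" by (rule p_measurable[OF assms(2)])
  have "(\<lambda>x. f x \<theta> \<gamma>) = (\<lambda>x. if x = \<gamma> then f \<gamma> \<theta> \<gamma> else if \<gamma> < x \<and> ereal x < I2 then K else 0)"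
    using on off by (auto simp: fun_eq_iff not_less)
  moreover have "\<dots> \<in> borel_measurable borel" by measurable
  ultimately have [measurable]: "(\<lambda>x. f x \<theta> \<gamma>) \<in> borel_measurable (distr_of_density p \<theta> \<gamma>)"
    by (simp add: distr_of_density_def)
  have "AE x in lborel. x \<noteq> \<gamma>" by (rule AE_lborel_singleton)
  then have "AE x in lborel. 0 < ennreal (p x \<theta> \<gamma>) \<longrightarrow> f x \<theta> \<gamma> = K"
  proof eventually_elim
    case (elim x)
    then show ?case using on[of x] p_off_support[of x \<gamma> \<theta>] by (cases "x < \<gamma> \<or> I2 \<le> ereal x") auto
  qed
  then have "AE x in distr_of_density p \<theta> \<gamma>. f x \<theta> \<gamma> = K"
    unfolding distr_of_density_def by (subst AE_density) auto
  then have "expct p f \<theta> \<gamma> = (LINT x|distr_of_density p \<theta> \<gamma>. K)"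
    unfolding expct_def by (intro integral_cong_AE) auto
  then show ?thesis using P.prob_space by simp
qed

text \<open>Near any \<open>(\<theta>, \<gamma>)\<close> with \<open>\<gamma> < x\<close> the log likelihood is an affine function minus \<open>\<psi>\<close>. Two derivatives, or one
  in \<open>\<gamma>\<close>, annihilate the affine part. Off the support the log likelihood is locally \<open>ln 0 = 0\<close>.\<close>

lemma expct_foldr_pd_loglik:
  assumes vs: "length vs \<ge> 2 \<or> vs = [(0, 1)]" "set vs \<subseteq> Basis"
    and z: "\<theta> \<in> \<Theta>" "\<gamma> \<in> I"
  shows "expct p (\<lambda>x \<theta> \<gamma>. foldr pd vs (case_prod (loglik p x)) (\<theta>, \<gamma>)) \<theta> \<gamma> = - foldr pd vs \<Psi> (\<theta>, \<gamma>)"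
proof (rule expct_eq_const[OF z])
  have vs_ne: "vs \<noteq> []" using vs by auto
  fix x :: real
  {
    assume x: "\<gamma> < x" "ereal x < I2"
    define U where "U = \<Theta> \<times> (I \<inter> {..<x})"
    have U: "open U" unfolding U_def by (intro open_Times open_Int open_Theta open_einterval open_lessThan)
    have zU: "(\<theta>, \<gamma>) \<in> U" using z x by (auto simp: U_def)
    have "foldr pd vs (case_prod (loglik p x)) (\<theta>, \<gamma>) = foldr pd vs (\<lambda>z. exponent F M x z - \<Psi> z) (\<theta>, \<gamma>)"
      by (rule foldr_pd_cong[OF U zU]) (use x in \<open>auto simp: U_def loglik_def p_on_support\<close>)
    also have "\<dots> = foldr pd vs (exponent F M x) (\<theta>, \<gamma>) - foldr pd vs \<Psi> (\<theta>, \<gamma>)"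
      by (rule foldr_pd_diff[OF open_domain _ Ck_on_exponent[OF open_domain] Ck_on_psi vs(2)]) (use z in auto)
    finally show "foldr pd vs (case_prod (loglik p x)) (\<theta>, \<gamma>) = - foldr pd vs \<Psi> (\<theta>, \<gamma>)"
      by (simp add: foldr_pd_exponent[OF vs(1)])
  }
  assume x: "x < \<gamma> \<or> I2 \<le> ereal x"
  define U where "U = (UNIV :: (real^'d) set) \<times> (if x < \<gamma> then {x<..} else UNIV)"
  have U: "open U" unfolding U_def by (intro open_Times) auto
  have zU: "(\<theta>, \<gamma>) \<in> U" by (auto simp: U_def)
  have "foldr pd vs (case_prod (loglik p x)) (\<theta>, \<gamma>) = foldr pd vs (\<lambda>_. 0) (\<theta>, \<gamma>)"
    by (rule foldr_pd_cong[OF U zU])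
      (use x in \<open>auto simp: U_def loglik_def p_off_support split: if_splits\<close>)
  then show "foldr pd vs (case_prod (loglik p x)) (\<theta>, \<gamma>) = 0"
    by (simp add: foldr_pd_const[OF vs_ne])
qed

lemma psi_differentiable: "z \<in> \<Theta> \<times> I \<Longrightarrow> \<Psi> differentiable at z"
  by (rule Ck_on_imp_differentiable[OF Ck_on_psi])

lemma foldr_pd_psi_differentiable:
  "z \<in> \<Theta> \<times> I \<Longrightarrow> set vs \<subseteq> Basis \<Longrightarrow> foldr pd vs \<Psi> differentiable at z"
  by (rule Ck_on_imp_differentiable[OF Ck_on_foldr_pd[OF open_domain Ck_on_psi]])

text \<open>\<open>Z = exp \<psi>\<close> is the integral of \<open>q\<close> from \<open>\<gamma>\<close> to \<open>I\<^sub>2\<close>. Raising the truncation point to \<open>s\<close> removes at least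
  \<open>m (s - \<gamma>)\<close>, where \<open>m > 0\<close> is the minimum of \<open>q\<close> on a compact interval, so the slope of \<open>Z\<close> is at most
  \<open>- m\<close>.\<close>

lemma pd_gamma_psi_neg:
  assumes "\<theta> \<in> \<Theta>" "\<gamma> \<in> I"
  shows "pd (0, 1) \<Psi> (\<theta>, \<gamma>) < 0"
proof -
  obtain b where b: "b \<in> I" "\<gamma> < b" using ex_greater_in_I[OF assms(2)] by auto
  define q where "q x = oTEF_q F M x \<theta>" for x
  have sub: "{\<gamma>..b} \<subseteq> I"
  proof
    fix x assume "x \<in> {\<gamma>..b}"
    then have "ereal \<gamma> \<le> ereal x" "ereal x \<le> ereal b" by auto
    then show "x \<in> I"
      using assms(2) b(1) less_le_trans[of I1 \<gamma> x] le_less_trans[of x b I2] by (auto simp: einterval_iff)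
  qed
  have "continuous_on I q"
    unfolding q_def oTEF_q_def by (intro continuous_intros F_continuous M_continuous)
  then have "continuous_on {\<gamma>..b} q" by (rule continuous_on_subset[OF _ sub])
  then obtain x0 where x0: "x0 \<in> {\<gamma>..b}" "\<And>x. x \<in> {\<gamma>..b} \<Longrightarrow> q x0 \<le> q x"
    using continuous_attains_inf[of "{\<gamma>..b}" q] b by fastforce
  define m where "m = q x0"
  have "m > 0" by (simp add: m_def q_def oTEF_q_def)
  define Z where "Z s = exp (\<psi> \<theta> s)" for s
  have Z: "has_bochner_integral lborel (\<lambda>x. Z s * p x \<theta> s) (Z s)" if "s \<in> I" for s
    using has_bochner_integral_mult_right[OF p_has_integral[OF assms(1) that], of "Z s"] by simp
  have Zp: "Z s * p x \<theta> s = q x * indicat_real {y. s \<le> y \<and> ereal y < I2} x" for s x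
    by (simp add: Z_def oTEF_density_def q_def exp_minus)
  have decr: "m * (s - \<gamma>) \<le> Z \<gamma> - Z s" if s: "\<gamma> < s" "s \<le> b" for s
  proof -
    have "s \<in> I" using sub s by auto
    have "has_bochner_integral lborel (\<lambda>x. Z \<gamma> * p x \<theta> \<gamma> - Z s * p x \<theta> s) (Z \<gamma> - Z s)"
      by (intro has_bochner_integral_diff Z assms(2) \<open>s \<in> I\<close>)
    moreover have "has_bochner_integral lborel (\<lambda>x. m * indicator {\<gamma>..<s} x) (m * (s - \<gamma>))"
    proof (rule has_bochner_integral_mult_right)
      have "has_bochner_integral lborel (indicat_real {\<gamma>..<s}) (measure lborel {\<gamma>..<s})"
        by (rule has_bochner_integral_real_indicator) (use s in auto)
      then show "has_bochner_integral lborel (indicat_real {\<gamma>..<s}) (s - \<gamma>)" using s by simp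
    qed
    moreover have "m * indicator {\<gamma>..<s} x \<le> Z \<gamma> * p x \<theta> \<gamma> - Z s * p x \<theta> s" for x
    proof -
      have "q x \<ge> 0" by (simp add: q_def oTEF_q_def)
      moreover have "m \<le> q x" "ereal x < I2" if "\<gamma> \<le> x" "x < s"
        using x0(2)[of x] that s \<open>s \<in> I\<close> by (auto simp: m_def einterval_iff intro: less_trans[of _ "ereal s"])
      ultimately show ?thesis using s unfolding Zp by (auto split: split_indicator)
    qed
    ultimately show ?thesis
      by (metis (no_types, lifting) has_bochner_integral_integral_eq integral_mono integrable.intros)
  qed
  have "((\<lambda>t. \<Psi> ((\<theta>, \<gamma>) + t *\<^sub>R (0, 1))) has_real_derivative pd (0, 1) \<Psi> ((\<theta>, \<gamma>) + 0 *\<^sub>R (0, 1))) (at 0)"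
    by (intro has_real_derivative_pd psi_differentiable) (use assms in simp)
  then have der: "((\<lambda>t. \<psi> \<theta> (\<gamma> + t)) has_real_derivative pd (0, 1) \<Psi> (\<theta>, \<gamma>)) (at 0)" by simp
  \<comment> \<open>If the slope of \<open>Z\<close> exceeded \<open>- m\<close>, this function would increase at \<open>0\<close>, contradicting \<open>decr\<close>.\<close>
  have "((\<lambda>t. Z (\<gamma> + t) + m * t) has_real_derivative Z \<gamma> * pd (0, 1) \<Psi> (\<theta>, \<gamma>) + m) (at 0)"
    unfolding Z_def by (auto intro!: derivative_eq_intros der)
  note inc = DERIV_pos_inc_right[OF this]
  have "Z \<gamma> * pd (0, 1) \<Psi> (\<theta>, \<gamma>) + m \<le> 0"
  proof (rule ccontr)
    assume "\<not> ?thesis"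
    then obtain d where d: "d > 0" "\<And>h. 0 < h \<Longrightarrow> h < d \<Longrightarrow> Z \<gamma> < Z (\<gamma> + h) + m * h"
      using inc by auto
    define h where "h = min (d / 2) (b - \<gamma>)"
    have "0 < h" "h < d" "\<gamma> + h \<le> b" using d(1) b by (auto simp: h_def)
    with d(2)[of h] decr[of "\<gamma> + h"] show False by simp
  qed
  with \<open>m > 0\<close> have "Z \<gamma> * pd (0, 1) \<Psi> (\<theta>, \<gamma>) < 0" by simp
  then show ?thesis by (simp add: Z_def mult_less_0_iff)
qed

text \<open>Along the line \<open>\<theta> + t v\<close> the increment \<open>h\<close> of \<open>\<psi>\<close> is the cumulant function of \<open>G = \<Sum>\<^sub>i v\<^sub>i F\<^sub>i\<close> and the
  quadratic form is \<open>h''(0)\<close>. If it were not positive, \<open>G\<close> would be almost surely constant, so the densities on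
  the line would be proportional, hence equal, contradicting identifiability.\<close>

lemma hessian_psi_pos:
  assumes \<theta>: "\<theta> \<in> \<Theta>" and \<gamma>: "\<gamma> \<in> I" and "v \<noteq> 0"
  shows "(\<Sum>i\<in>UNIV. v $ i * (\<Sum>j\<in>UNIV. v $ j * pd (axis i 1, 0) (pd (axis j 1, 0) \<Psi>) (\<theta>, \<gamma>))) > 0"
    (is "?D > 0")
proof (rule ccontr)
  assume "\<not> ?D > 0"
  obtain d where d: "d > 0" "ball \<theta> d \<subseteq> \<Theta>" using open_Theta \<theta> openE by blast
  define r where "r = d / norm v"
  have "r > 0" using d \<open>v \<noteq> 0\<close> by (simp add: r_def)
  have in_Theta: "\<theta> + t *\<^sub>R v \<in> \<Theta>" if "\<bar>t\<bar> < r" for t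
  proof -
    have "\<bar>t\<bar> * norm v < d" using that \<open>v \<noteq> 0\<close> by (simp add: r_def field_simps)
    then show ?thesis using d(2) by (auto simp: dist_norm subset_eq)
  qed
  define u :: "(real^'d) \<times> real" where "u = (v, 0)"
  have u: "u = (\<Sum>i\<in>UNIV. v $ i *\<^sub>R (axis i 1, 0))"
  proof (rule prod_eqI)
    show "fst u = fst (\<Sum>i\<in>UNIV. v $ i *\<^sub>R (axis i 1, 0 :: real))"
      by (simp add: u_def fst_sum vec_eq_iff axis_def if_distrib cong: if_cong)
  qed (simp add: u_def snd_sum)
  define g where "g y = (\<Sum>j\<in>UNIV. v $ j * pd (axis j 1, 0) \<Psi> y)" for y
  have diff1: "pd (axis j 1, 0) \<Psi> differentiable at (\<theta>, \<gamma>)" for j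
    using foldr_pd_psi_differentiable[of "(\<theta>, \<gamma>)" "[(axis j 1, 0)]"] \<theta> \<gamma> by (simp add: axis_in_Basis_prod)
  have g: "g differentiable at (\<theta>, \<gamma>)"
    unfolding g_def[abs_def] by (auto intro!: differentiable_sum simp: diff1)
  have pd_g: "pd u g (\<theta>, \<gamma>) = ?D"
    unfolding u pd_sum_direction[OF g] unfolding g_def[abs_def]
    by (intro sum.cong refl arg_cong2[where f = "(*)"] pd_sum_cmult diff1)
  define h where "h t = \<psi> (\<theta> + t *\<^sub>R v) \<gamma> - \<psi> \<theta> \<gamma>" for t
  define h' where "h' t = g ((\<theta>, \<gamma>) + t *\<^sub>R u)" for t
  \<comment> \<open>Cut off outside \<open>I\<close> for the sake of measurability.\<close>
  define G where "G x = indicator I x *\<^sub>R (\<Sum>i\<in>UNIV. F i x * v $ i)" for x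
  \<comment> \<open>Moving along the line is exponential tilting by \<open>G\<close>.\<close>
  have tilt: "p x (\<theta> + t *\<^sub>R v) \<gamma> = p x \<theta> \<gamma> * exp (t * G x - h t)" for x t
  proof (cases "\<gamma> \<le> x \<and> ereal x < I2")
    case True
    then have "x \<in> I" using support_subset \<gamma> by auto
    then show ?thesis using True
      by (simp add: p_on_support exponent_def G_def h_def algebra_simps sum.distrib sum_distrib_left flip: exp_add)
  qed (auto simp: p_off_support not_le not_less)
  have "AE x in lborel. p x \<theta> \<gamma> = 0 \<or> G x = h' 0"
  proof (rule cumulant_second_derivative_nonpos_imp_AE_const[where h = h and D = ?D])
    show "(\<lambda>x. p x \<theta> \<gamma>) \<in> borel_measurable lborel" using p_measurable[OF \<gamma>] by simp
    have "G \<in> borel_measurable borel" unfolding G_def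
      by (intro borel_measurable_continuous_on_indicator borel_einterval continuous_intros F_continuous)
    then show "G \<in> borel_measurable lborel" by simp
    show "p x \<theta> \<gamma> \<ge> 0" for x by (rule p_nonneg)
    show "r > 0" by fact
    show "h 0 = 0" by (simp add: h_def)
    show "?D \<le> 0" using \<open>\<not> ?D > 0\<close> by simp
    show "has_bochner_integral lborel (\<lambda>x. p x \<theta> \<gamma> * exp (t * G x)) (exp (h t))" if "\<bar>t\<bar> < r" for t
    proof -
      have "has_bochner_integral lborel (\<lambda>x. exp (h t) * p x (\<theta> + t *\<^sub>R v) \<gamma>) (exp (h t) * 1)"
        by (intro has_bochner_integral_mult_right p_has_integral in_Theta that \<gamma>)
      moreover have "exp (h t) * p x (\<theta> + t *\<^sub>R v) \<gamma> = p x \<theta> \<gamma> * exp (t * G x)" for x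
        unfolding tilt by (simp add: exp_diff)
      ultimately show ?thesis by simp
    qed
    show "(h has_real_derivative h' t) (at t)" if "\<bar>t\<bar> < r" for t
    proof -
      have *: "\<Psi> differentiable at ((\<theta>, \<gamma>) + t *\<^sub>R u)"
        by (rule psi_differentiable) (use in_Theta[OF that] \<gamma> in \<open>simp add: u_def\<close>)
      have "h' t = pd u \<Psi> ((\<theta>, \<gamma>) + t *\<^sub>R u)"
        unfolding h'_def g_def
        using pd_sum_direction[OF *, of "\<lambda>i. v $ i" "\<lambda>i. (axis i 1, 0)" UNIV] by (simp only: u)
      moreover have "((\<lambda>t. \<Psi> ((\<theta>, \<gamma>) + t *\<^sub>R u)) has_real_derivative pd u \<Psi> ((\<theta>, \<gamma>) + t *\<^sub>R u)) (at t)"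
        by (rule has_real_derivative_pd[OF *])
      ultimately show ?thesis
        unfolding h_def by (auto intro!: derivative_eq_intros simp: u_def)
    qed
    have "((\<lambda>t. g ((\<theta>, \<gamma>) + t *\<^sub>R u)) has_real_derivative pd u g ((\<theta>, \<gamma>) + 0 *\<^sub>R u)) (at 0)"
      by (rule has_real_derivative_pd) (simp add: g)
    then show "(h' has_real_derivative ?D) (at 0)" by (simp add: h'_def[abs_def] pd_g)
  qed
  define t where "t = r / 2"
  have t: "\<bar>t\<bar> < r" "t \<noteq> 0" using \<open>r > 0\<close> by (auto simp: t_def)
  define c where "c = exp (t * h' 0 - h t)"
  have AE: "AE x in lborel. p x (\<theta> + t *\<^sub>R v) \<gamma> = c * p x \<theta> \<gamma>"
    using \<open>AE x in lborel. p x \<theta> \<gamma> = 0 \<or> G x = h' 0\<close>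
    by eventually_elim (auto simp: tilt c_def)
  have [measurable]: "(\<lambda>x. p x \<theta>' \<gamma>) \<in> borel_measurable borel" for \<theta>' by (rule p_measurable[OF \<gamma>])
  have "1 = (LINT x|lborel. p x (\<theta> + t *\<^sub>R v) \<gamma>)"
    using p_has_integral[OF in_Theta[OF t(1)] \<gamma>] by (simp add: has_bochner_integral_integral_eq)
  also have "\<dots> = (LINT x|lborel. c * p x \<theta> \<gamma>)"
    by (rule integral_cong_AE) (use AE in auto)
  also have "\<dots> = c"
    using has_bochner_integral_integral_eq[OF p_has_integral[OF \<theta> \<gamma>]] by simp
  finally have "c = 1" by simp
  with AE have AE_eq: "AE x in lborel. p x (\<theta> + t *\<^sub>R v) \<gamma> = p x \<theta> \<gamma>" by simp
  have "distr_of_density p (\<theta> + t *\<^sub>R v) \<gamma> = distr_of_density p \<theta> \<gamma>"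
    unfolding distr_of_density_def by (rule density_cong) (use AE_eq in auto)
  then have "\<theta> + t *\<^sub>R v = \<theta>" by (rule identifiable[OF in_Theta[OF t(1)] \<theta> \<gamma>])
  then show False using t(2) \<open>v \<noteq> 0\<close> by simp
qed

section \<open>The matching equations\<close>

abbreviation e_theta :: "'d \<Rightarrow> (real^'d) \<times> real" where "e_theta i \<equiv> (axis i 1, 0)"
abbreviation e_gamma :: "(real^'d) \<times> real" where "e_gamma \<equiv> (0, 1)"

lemmas e_Basis = axis_in_Basis_prod snd_in_Basis_prod

lemma
  assumes z: "\<theta> \<in> \<Theta>" "\<gamma> \<in> I"
  shows cfun_eq: "cfun p \<theta> \<gamma> = - pd e_gamma \<Psi> (\<theta>, \<gamma>)"
    and A11_eq: "A11 p i \<theta> \<gamma> = - pd (e_theta i) (pd e_gamma \<Psi>) (\<theta>, \<gamma>)"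
    and A21_eq: "A21 p i j \<theta> \<gamma> = - pd (e_theta i) (pd (e_theta j) (pd e_gamma \<Psi>)) (\<theta>, \<gamma>)"
    and A30_eq: "A30 p i j k \<theta> \<gamma> = - pd (e_theta i) (pd (e_theta j) (pd (e_theta k) \<Psi>)) (\<theta>, \<gamma>)"
    and g_lower_eq: "g_lower p i j \<theta> \<gamma> = pd (e_theta i) (pd (e_theta j) \<Psi>) (\<theta>, \<gamma>)"
proof -
  note E = expct_foldr_pd_loglik[OF _ _ z]
  note ext = dtheta_eq_pd[abs_def] dgamma_eq_pd[abs_def] case_prod_dtheta case_prod_dgamma
  show "cfun p \<theta> \<gamma> = - pd e_gamma \<Psi> (\<theta>, \<gamma>)"
    using E[of "[e_gamma]"] by (simp add: cfun_def ext e_Basis)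
  show "A11 p i \<theta> \<gamma> = - pd (e_theta i) (pd e_gamma \<Psi>) (\<theta>, \<gamma>)"
    using E[of "[e_theta i, e_gamma]"] by (simp add: A11_def ext e_Basis)
  show "A21 p i j \<theta> \<gamma> = - pd (e_theta i) (pd (e_theta j) (pd e_gamma \<Psi>)) (\<theta>, \<gamma>)"
    using E[of "[e_theta i, e_theta j, e_gamma]"] by (simp add: A21_def ext e_Basis)
  show "A30 p i j k \<theta> \<gamma> = - pd (e_theta i) (pd (e_theta j) (pd (e_theta k) \<Psi>)) (\<theta>, \<gamma>)"
    using E[of "[e_theta i, e_theta j, e_theta k]"] by (simp add: A30_def ext e_Basis)
  show "g_lower p i j \<theta> \<gamma> = pd (e_theta i) (pd (e_theta j) \<Psi>) (\<theta>, \<gamma>)"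
    using E[of "[e_theta i, e_theta j]"] by (simp add: g_lower_def ext e_Basis)
qed

lemma pd_psi_commute:
  assumes "z \<in> \<Theta> \<times> I" "u \<in> Basis" "v \<in> Basis" "set vs \<subseteq> Basis"
  shows "pd u (pd v (foldr pd vs \<Psi>)) z = pd v (pd u (foldr pd vs \<Psi>)) z"
  by (rule pd_commute[OF open_domain, of 0])
    (use assms in \<open>auto intro: Ck_on_foldr_pd[OF open_domain Ck_on_psi]\<close>)

lemma pd_psi_commute_inner:
  assumes "z \<in> \<Theta> \<times> I" "u \<in> Basis" "v \<in> Basis"
  shows "pd w (pd u (pd v \<Psi>)) z = pd w (pd v (pd u \<Psi>)) z"
  by (rule pd_cong[OF open_domain assms(1)]) (use pd_psi_commute[of _ u v "[]"] assms in auto)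

text \<open>The Fisher information \<open>g\<^sub>\<theta>\<close> written through \<open>\<psi>\<close>, so that it can be differentiated as a function on the
  product space.\<close>

definition hess :: "(real^'d) \<times> real \<Rightarrow> real^'d^'d" where
  "hess z = (\<chi> i j. pd (e_theta i) (pd (e_theta j) \<Psi>) z)"

lemma g_theta_eq: "\<theta> \<in> \<Theta> \<Longrightarrow> \<gamma> \<in> I \<Longrightarrow> g_theta p \<theta> \<gamma> = hess (\<theta>, \<gamma>)"
  by (simp add: g_theta_def hess_def g_lower_eq)

lemma hess_differentiable: "z \<in> \<Theta> \<times> I \<Longrightarrow> (\<lambda>y. hess y $ i $ j) differentiable at z"
  using foldr_pd_psi_differentiable[of z "[e_theta i, e_theta j]"] by (simp add: hess_def e_Basis)

lemma invertible_hess: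
  assumes "z \<in> \<Theta> \<times> I"
  shows "invertible (hess z)"
proof -
  have "v = 0" if "hess z *v v = 0" for v
  proof (rule ccontr)
    assume "v \<noteq> 0"
    have "(\<Sum>i\<in>UNIV. v $ i * (\<Sum>j\<in>UNIV. v $ j * pd (e_theta i) (pd (e_theta j) \<Psi>) z))
      = (\<Sum>i\<in>UNIV. v $ i * (hess z *v v) $ i)"
      by (simp add: hess_def matrix_vector_mult_def mult.commute)
    then show False using that hessian_psi_pos[of "fst z" "snd z" v] assms \<open>v \<noteq> 0\<close> by auto
  qed
  then show ?thesis
    unfolding invertible_left_inverse matrix_left_invertible_ker by blast
qed

text \<open>Jacobi's formula pairs \<open>\<partial> g\<^sub>i\<^sub>j\<close> with the entry \<open>(j, i)\<close> of the inverse; symmetry of \<open>g\<close> turns this into the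
  index order \<open>g\<^sup>i\<^sup>j\<close> in which the matching equations contract.\<close>

lemma pd_ln_det_hess:
  assumes z: "z \<in> \<Theta> \<times> I"
  shows "pd v (\<lambda>y. ln (det (hess y))) z
    = (\<Sum>i\<in>UNIV. \<Sum>j\<in>UNIV. pd v (pd (e_theta i) (pd (e_theta j) \<Psi>)) z * matrix_inv (hess z) $ i $ j)"
proof -
  have "pd v (\<lambda>y. ln (det (hess y))) z
    = (\<Sum>i\<in>UNIV. \<Sum>j\<in>UNIV. pd v (pd (e_theta i) (pd (e_theta j) \<Psi>)) z * matrix_inv (hess z) $ j $ i)"
    using pd_ln_det(1)[OF hess_differentiable[OF z] invertible_hess[OF z]] by (simp add: hess_def)
  also have "\<dots> = (\<Sum>j\<in>UNIV. \<Sum>i\<in>UNIV. pd v (pd (e_theta j) (pd (e_theta i) \<Psi>)) z * matrix_inv (hess z) $ j $ i)"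
    by (subst sum.swap) (simp add: pd_psi_commute_inner[OF z] e_Basis)
  finally show ?thesis .
qed

text \<open>Both equations are rewritten in terms of the coordinate derivatives of the three scalar functions
  \<open>L\<pi> = log \<pi>\<close>, \<open>Ld = log det g\<close> and \<open>Lc = log c\<close>, with \<open>V\<close> the \<open>\<theta>\<close>-components of \<open>\<chi>\<close>. After that the two sides
  agree by linearity.\<close>

lemma matching_equations:
  assumes z: "\<theta> \<in> \<Theta>" "\<gamma> \<in> I"
    and \<pi>: "case_prod \<pi> differentiable at (\<theta>, \<gamma>)" "\<pi> \<theta> \<gamma> > 0"
  shows "prob_matching_eq p \<pi> \<theta> \<gamma> \<longleftrightarrow>
      Lie_derivative (chi_field p)
        (\<lambda>\<theta> \<gamma>. ln (\<pi> \<theta> \<gamma>) - ln (det (g_theta p \<theta> \<gamma>)) - 1/2 * ln (g_gamma_gamma \<psi> \<theta> \<gamma>)) \<theta> \<gamma> = 0" (is ?P)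
    and "moment_matching_eq p \<pi> \<theta> \<gamma> \<longleftrightarrow>
      Lie_derivative (chi_field p)
        (\<lambda>\<theta> \<gamma>. ln (\<pi> \<theta> \<gamma>) - 1/2 * ln (det (g_theta p \<theta> \<gamma>)) - ln (g_gamma_gamma \<psi> \<theta> \<gamma>)) \<theta> \<gamma> = 0" (is ?M)
proof -
  let ?z = "(\<theta>, \<gamma>)"
  have zS: "?z \<in> \<Theta> \<times> I" using z by simp
  define L\<pi> where "L\<pi> y = ln (case_prod \<pi> y)" for y
  define Ld where "Ld y = ln (det (hess y))" for y
  define Lc where "Lc y = ln (- pd e_gamma \<Psi> y)" for y
  define inv where "inv i j = matrix_inv (hess ?z) $ i $ j" for i j
  define V where "V j = (\<Sum>i\<in>UNIV. A11 p i \<theta> \<gamma> * inv i j)" for j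
  have c_pos: "- pd e_gamma \<Psi> y > 0" if "y \<in> \<Theta> \<times> I" for y
    using pd_gamma_psi_neg[of "fst y" "snd y"] that by auto
  have dL\<pi>: "L\<pi> differentiable at ?z" unfolding L\<pi>_def[abs_def] by (rule pd_ln(2)) (use \<pi> in auto)
  have dLd: "Ld differentiable at ?z"
    unfolding Ld_def[abs_def] by (rule pd_ln_det(2)[OF hess_differentiable[OF zS] invertible_hess[OF zS]])
  have dLc: "Lc differentiable at ?z"
    unfolding Lc_def[abs_def]
    by (rule pd_ln(2)) (use c_pos[OF zS] foldr_pd_psi_differentiable[OF zS, of "[e_gamma]"] in
        \<open>auto intro!: differentiable_minus simp: e_Basis\<close>)
  have g_upper: "g_upper p i j \<theta> \<gamma> = inv i j" for i j
    by (simp add: g_upper_def inv_def g_theta_eq z)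
  have contract: "(\<Sum>i\<in>UNIV. \<Sum>j\<in>UNIV. A11 p i \<theta> \<gamma> * inv i j * t j) = (\<Sum>j\<in>UNIV. V j * t j)" for t
    by (subst sum.swap) (simp add: V_def sum_distrib_right)
  have Lie: "Lie_derivative (chi_field p) f \<theta> \<gamma>
      = pd e_gamma (case_prod f) ?z + (\<Sum>j\<in>UNIV. V j * pd (e_theta j) (case_prod f) ?z)" for f
    by (simp add: Lie_derivative_def chi_field_def V_def g_upper dgamma_eq_pd dtheta_eq_pd)
  have pd_L\<pi>: "pd v (\<lambda>(\<theta>, \<gamma>). ln (\<pi> \<theta> \<gamma>)) ?z = pd v L\<pi> ?z" for v
    by (simp add: L\<pi>_def[abs_def] case_prod_unfold)
  have pd_Lc: "pd v (\<lambda>(\<theta>, \<gamma>). ln (cfun p \<theta> \<gamma>)) ?z = pd v Lc ?z" for v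
    by (rule pd_cong[OF open_domain zS]) (auto simp: Lc_def cfun_eq)
  have pd_Ld: "pd v (\<lambda>(\<theta>, \<gamma>). ln (det (g_theta p \<theta> \<gamma>))) ?z = pd v Ld ?z" for v
    by (rule pd_cong[OF open_domain zS]) (auto simp: Ld_def g_theta_eq)
  have pd_Ld_eq: "pd v Ld ?z = (\<Sum>i\<in>UNIV. \<Sum>j\<in>UNIV. pd v (pd (e_theta i) (pd (e_theta j) \<Psi>)) ?z * inv i j)" for v
    unfolding Ld_def[abs_def] inv_def by (rule pd_ln_det_hess[OF zS])
  have ln_g: "ln (g_gamma_gamma \<psi> \<theta> \<gamma>) = 2 * Lc (\<theta>, \<gamma>)" if "\<theta> \<in> \<Theta>" "\<gamma> \<in> I" for \<theta> \<gamma>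
  proof -
    have "g_gamma_gamma \<psi> \<theta> \<gamma> = (- pd e_gamma \<Psi> (\<theta>, \<gamma>)) ^ 2"
      by (simp add: g_gamma_gamma_def dgamma_eq_pd)
    then show ?thesis using c_pos[of "(\<theta>, \<gamma>)"] that by (simp add: Lc_def ln_realpow ln_minus)
  qed
  have pd_potential: "pd v (\<lambda>(\<theta>, \<gamma>). ln (\<pi> \<theta> \<gamma>) - a * ln (det (g_theta p \<theta> \<gamma>)) - b * ln (g_gamma_gamma \<psi> \<theta> \<gamma>)) ?z
      = pd v L\<pi> ?z - a * pd v Ld ?z - 2 * b * pd v Lc ?z" for v a b
  proof -
    have "pd v (\<lambda>(\<theta>, \<gamma>). ln (\<pi> \<theta> \<gamma>) - a * ln (det (g_theta p \<theta> \<gamma>)) - b * ln (g_gamma_gamma \<psi> \<theta> \<gamma>)) ?z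
      = pd v (\<lambda>y. L\<pi> y - a * Ld y - 2 * b * Lc y) ?z"
      by (rule pd_cong[OF open_domain zS]) (auto simp: L\<pi>_def Ld_def g_theta_eq ln_g)
    then show ?thesis using dL\<pi> dLd dLc by (simp add: pd_diff pd_cmult)
  qed
  have Lie_potential: "Lie_derivative (chi_field p)
        (\<lambda>\<theta> \<gamma>. ln (\<pi> \<theta> \<gamma>) - a * ln (det (g_theta p \<theta> \<gamma>)) - b * ln (g_gamma_gamma \<psi> \<theta> \<gamma>)) \<theta> \<gamma>
      = pd e_gamma L\<pi> ?z - a * pd e_gamma Ld ?z - 2 * b * pd e_gamma Lc ?z
        + (\<Sum>j\<in>UNIV. V j * (pd (e_theta j) L\<pi> ?z - a * pd (e_theta j) Ld ?z - 2 * b * pd (e_theta j) Lc ?z))" for a b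
    unfolding Lie pd_potential ..

  \<comment> \<open>\<open>\<partial>\<^sub>i A\<^sup>(\<^sup>1\<^sup>,\<^sup>1\<^sup>)\<^sub>j = - \<partial>\<^sub>\<gamma> g\<^sub>i\<^sub>j\<close>, so its contraction is the same as that of \<open>A\<^sup>(\<^sup>2\<^sup>,\<^sup>1\<^sup>)\<close>.\<close>
  have dA11: "(\<Sum>i\<in>UNIV. \<Sum>j\<in>UNIV. dtheta i (A11 p j) \<theta> \<gamma> * inv i j) = - pd e_gamma Ld ?z"
  proof -
    have "dtheta i (A11 p j) \<theta> \<gamma> = - pd e_gamma (pd (e_theta i) (pd (e_theta j) \<Psi>)) ?z" for i j
    proof -
      have "dtheta i (A11 p j) \<theta> \<gamma> = pd (e_theta i) (\<lambda>y. (- 1) * pd e_gamma (pd (e_theta j) \<Psi>) y) ?z"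
        unfolding dtheta_eq_pd
        by (rule pd_cong[OF open_domain zS])
          (use pd_psi_commute[of _ _ e_gamma "[]"] in \<open>auto simp: A11_eq e_Basis\<close>)
      also have "\<dots> = (- 1) * pd (e_theta i) (pd e_gamma (pd (e_theta j) \<Psi>)) ?z"
        using foldr_pd_psi_differentiable[OF zS, of "[e_gamma, e_theta j]"] by (intro pd_cmult) (simp add: e_Basis)
      also have "pd (e_theta i) (pd e_gamma (pd (e_theta j) \<Psi>)) ?z = pd e_gamma (pd (e_theta i) (pd (e_theta j) \<Psi>)) ?z"
        using pd_psi_commute[OF zS, of "e_theta i" e_gamma "[e_theta j]"] by (simp add: e_Basis)
      finally show ?thesis by simp
    qed
    then show ?thesis by (simp add: pd_Ld_eq sum_negf)
  qed
  have A21: "(\<Sum>i\<in>UNIV. \<Sum>j\<in>UNIV. A21 p i j \<theta> \<gamma> * inv i j) = - pd e_gamma Ld ?z"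
  proof -
    have "A21 p i j \<theta> \<gamma> = - pd e_gamma (pd (e_theta i) (pd (e_theta j) \<Psi>)) ?z" for i j
      using pd_psi_commute_inner[OF zS, of "e_theta j" e_gamma "e_theta i"]
        pd_psi_commute[OF zS, of "e_theta i" e_gamma "[e_theta j]"]
      by (simp add: A21_eq z e_Basis)
    then show ?thesis by (simp add: pd_Ld_eq sum_negf)
  qed
  have A30: "(\<Sum>k\<in>UNIV. \<Sum>m\<in>UNIV. A30 p j k m \<theta> \<gamma> * inv k m) = - pd (e_theta j) Ld ?z" for j
    by (simp add: pd_Ld_eq A30_eq z sum_negf)
  have dg: "dtheta k (g_lower p i j) \<theta> \<gamma> = pd (e_theta k) (pd (e_theta i) (pd (e_theta j) \<Psi>)) ?z" for i j k
    unfolding dtheta_eq_pd by (rule pd_cong[OF open_domain zS]) (auto simp: g_lower_eq)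
  have dg_outer: "dtheta k (g_lower p i j) \<theta> \<gamma> = dtheta i (g_lower p k j) \<theta> \<gamma>" for i j k
    unfolding dg using pd_psi_commute[OF zS, of "e_theta k" "e_theta i" "[e_theta j]"] by (simp add: e_Basis)
  have dg_inner: "dtheta k (g_lower p i j) \<theta> \<gamma> = dtheta k (g_lower p j i) \<theta> \<gamma>" for i j k
    unfolding dg by (rule pd_psi_commute_inner[OF zS]) (simp_all add: e_Basis)
  \<comment> \<open>All first derivatives of \<open>g\<close> are totally symmetric in their three indices.\<close>
  have Christoffel: "Christoffel p m k j \<theta> \<gamma> - Christoffel p k j m \<theta> \<gamma> = 0" for m k j
    unfolding Christoffel_def using dg_outer[of j m k] dg_outer[of k m j] dg_outer[of m j k]
      dg_inner[of j m k] dg_inner[of k m j] dg_inner[of m j k] by simp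

  show ?P
    unfolding prob_matching_eq_def g_upper contract dgamma_eq_pd[of "\<lambda>\<theta> \<gamma>. ln (_ \<theta> \<gamma>)"]
      dtheta_eq_pd[of _ "\<lambda>\<theta> \<gamma>. ln (_ \<theta> \<gamma>)"] pd_L\<pi> pd_Lc pd_Ld dA11 Christoffel
      Lie_potential[of 1 "1/2", unfolded mult_1_left]
    by (auto simp add: algebra_simps sum.distrib sum_subtractf)
  show ?M
    unfolding moment_matching_eq_def g_upper contract dgamma_eq_pd dtheta_eq_pd pd_L\<pi> pd_Lc A21 A30
      Lie_potential[of "1/2" 1, unfolded mult_1_left]
    by (auto simp add: algebra_simps sum.distrib sum_subtractf sum_distrib_left)
qed

end

theorem mainTheorem4:
  fixes \<Theta> :: "(real^'d::finite) set"
    and I1 I2 :: ereal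
    and F :: "'d \<Rightarrow> real \<Rightarrow> real"
    and M :: "real \<Rightarrow> real"
    and \<psi> \<pi> :: "real^'d \<Rightarrow> real \<Rightarrow> real"
    and p :: "real \<Rightarrow> real^'d \<Rightarrow> real \<Rightarrow> real"
  assumes family: "oTEF \<Theta> I1 I2 F M \<psi>"
    and p: "p = oTEF_density I2 F M \<psi>"
    and prior_smooth: "smooth_on (\<Theta> \<times> einterval I1 I2) (\<lambda>(\<theta>, \<gamma>). \<pi> \<theta> \<gamma>)"
    and prior_pos: "\<And>\<theta> \<gamma>. \<theta> \<in> \<Theta> \<Longrightarrow> \<gamma> \<in> einterval I1 I2 \<Longrightarrow> 0 < \<pi> \<theta> \<gamma>"
  shows "\<forall>\<theta>\<in>\<Theta>. \<forall>\<gamma>\<in>einterval I1 I2.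
      (prob_matching_eq p \<pi> \<theta> \<gamma> \<longleftrightarrow>
        Lie_derivative (chi_field p)
          (\<lambda>\<theta> \<gamma>. ln (\<pi> \<theta> \<gamma>) - ln (det (g_theta p \<theta> \<gamma>)) - 1/2 * ln (g_gamma_gamma \<psi> \<theta> \<gamma>)) \<theta> \<gamma> = 0) \<and>
      (moment_matching_eq p \<pi> \<theta> \<gamma> \<longleftrightarrow>
        Lie_derivative (chi_field p)
          (\<lambda>\<theta> \<gamma>. ln (\<pi> \<theta> \<gamma>) - 1/2 * ln (det (g_theta p \<theta> \<gamma>)) - ln (g_gamma_gamma \<psi> \<theta> \<gamma>)) \<theta> \<gamma> = 0)"
proof -
  interpret oTEF \<Theta> I1 I2 F M \<psi> by (rule family)
  have "case_prod \<pi> differentiable at (\<theta>, \<gamma>)" if "\<theta> \<in> \<Theta>" "\<gamma> \<in> einterval I1 I2" for \<theta> \<gamma>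
    using prior_smooth that by (auto simp: smooth_on_def intro!: Ck_on_imp_differentiable[of 0])
  then show ?thesis unfolding p using matching_equations prior_pos by simp
qed

end
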